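(* Let $K$ be a function field of transcendence degree one, i.e. a finite field extension of $\mathbb{F}_q(t)$. Let $\phi_1:A\to K\{\tau\},\dots,\phi_g:A\to K\{\tau\}$ be Drinfeld modules. Let $(x_1,\dots,x_g)\in\mathbb{G}_a^g(K)$ and let $\Gamma\subset\mathbb{G}_a^g(K)$ be the cyclic $(\phi_1,\dots,\phi_g)$-submodule generated by $(x_1,\dots,x_g)$. Let $V\subset\mathbb{G}_a^g$ be an affine subvariety defined over $K$. Then $V(K)\cap\Gamma$ is a finite union of cosets of $(\phi_1,\dots,\phi_g)$-submodules of $\Gamma$.
   Context: Let $p$ be a prime, $q$ a power of $p$, $A=\mathbb{F}_q[t]$, and $g$ a positive integer. Let $K\{\tau\}$ be the ring of polynomials in $\tau$ with coefficients in $K$, where $\tau$ is the Frobenius $x\mapsto x^q$; addition is the usual one and multiplication is composition. A Drinfeld module is a ring morphism $\phi:A\to K\{\tau\}$, $a\mapsto\phi_a$, such that the coefficient of $\tau^0$ in $\phi_a$ is $a$ for every $a\in A$, and there is some $a\in A$ with $\phi_a\neq a\tau^0$. Given Drinfeld modules $\phi_1,\dots,\phi_g$, the ring $A$ acts on $\mathbb{G}_a^g(\overline K)=\overline K^g$ coordinate-wise by $\phi_a(z_1,\dots,z_g)=((\phi_1)_a(z_1),\dots,(\phi_g)_a(z_g))$. A $(\phi_1,\dots,\phi_g)$-submodule is a subgroup of $\mathbb{G}_a^g(\overline K)$ invariant under this action; a submodule of $\Gamma$ is one contained in $\Gamma$. The cyclic submodule generated by $(x_1,\dots,x_g)$ is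 $\{\phi_a(x_1,\dots,x_g): a\in A\}$. All subvarieties are closed. Finite unions may be empty. *)

theory Defs
  imports
    "HOL-Analysis.Finite_Cartesian_Product"
    "HOL-Library.Poly_Mapping"
    "HOL-Computational_Algebra.Computational_Algebra"
    "HOL-Algebra.Algebraic_Closure_Type"
begin

text \<open>
  The finite field with \<open>q\<close> elements is a type \<open>'f :: {finite, field}\<close>, so \<open>q = CARD('f)\<close>,
  \<open>A = 'f poly\<close> and the field of rational functions is \<open>'f poly fract\<close>. The field \<open>K\<close> is a
  type \<open>'k :: field\<close> together with an embedding \<open>\<iota>\<close>, and its algebraic closure is
  \<open>'k alg_closure\<close>, with inclusion \<^const>\<open>to_ac\<close>.
\<close>

definition finite_field_extension :: "('a::field \<Rightarrow> 'b::field) \<Rightarrow> bool" where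
  "finite_field_extension \<iota> \<longleftrightarrow>
     \<iota> 1 = 1 \<and> (\<forall>x y. \<iota> (x + y) = \<iota> x + \<iota> y) \<and> (\<forall>x y. \<iota> (x * y) = \<iota> x * \<iota> y) \<and>
     (\<exists>B. finite_dimensional_vector_space (\<lambda>c x. \<iota> c * x) B)"

text \<open>
  The elements \<open>\<Sum>j. c\<^sub>j \<tau>\<^sup>j\<close> of \<open>K{\<tau>}\<close> are represented by the polynomials
  \<open>\<Sum>j. c\<^sub>j X^(q^j)\<close> that they define: \<open>\<tau>\<close> is \<open>X^q\<close>, the coefficient of \<open>\<tau>\<^sup>j\<close> is the coefficient
  of \<open>X^(q^j)\<close> (so that of \<open>\<tau>\<^sup>0\<close> is the coefficient of \<open>X\<close>), the product is \<^const>\<open>pcompose\<close>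
  with unit \<open>X = [:0, 1:]\<close>, and the action on a point is \<^const>\<open>poly\<close>.
\<close>

definition twisted_polys :: "nat \<Rightarrow> 'k::field poly set" where
  "twisted_polys q = {\<Sum>j\<le>n. monom (c j) (q ^ j) | (n::nat) c. True}"

definition drinfeld_module ::
  "('f::{finite,field} poly fract \<Rightarrow> 'k::field) \<Rightarrow> ('f poly \<Rightarrow> 'k poly) \<Rightarrow> bool" where
  "drinfeld_module \<iota> \<phi> \<longleftrightarrow>
     (\<forall>a. \<phi> a \<in> twisted_polys CARD('f)) \<and>
     \<phi> 1 = [:0, 1:] \<and>
     (\<forall>a b. \<phi> (a + b) = \<phi> a + \<phi> b) \<and>
     (\<forall>a b. \<phi> (a * b) = pcompose (\<phi> a) (\<phi> b)) \<and>
     (\<forall>a. coeff (\<phi> a) 1 = \<iota> (to_fract a)) \<and>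
     (\<exists>a. \<phi> a \<noteq> smult (\<iota> (to_fract a)) [:0, 1:])"

definition act ::
  "('n::finite \<Rightarrow> 'f::{finite,field} poly \<Rightarrow> 'k::field poly) \<Rightarrow>
     'f poly \<Rightarrow> 'k alg_closure ^ 'n \<Rightarrow> 'k alg_closure ^ 'n" where
  "act \<phi> a z = (\<chi> i. poly (map_poly to_ac (\<phi> i a)) (z $ i))"

definition is_submodule ::
  "('n::finite \<Rightarrow> 'f::{finite,field} poly \<Rightarrow> 'k::field poly) \<Rightarrow> ('k alg_closure ^ 'n) set \<Rightarrow> bool"
  where
  "is_submodule \<phi> H \<longleftrightarrow>
     0 \<in> H \<and> (\<forall>x\<in>H. \<forall>y\<in>H. x + y \<in> H) \<and> (\<forall>x\<in>H. - x \<in> H) \<and> (\<forall>a. \<forall>x\<in>H. act \<phi> a x \<in> H)"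

definition cyclic_submodule ::
  "('n::finite \<Rightarrow> 'f::{finite,field} poly \<Rightarrow> 'k::field poly) \<Rightarrow>
     'k alg_closure ^ 'n \<Rightarrow> ('k alg_closure ^ 'n) set" where
  "cyclic_submodule \<phi> x = range (\<lambda>a. act \<phi> a x)"

definition rational_points :: "('k::field alg_closure ^ 'n) set" where
  "rational_points = {z. \<forall>i. z $ i \<in> range to_ac}"

text \<open>
  A polynomial over \<open>K\<close> in variables indexed by \<open>'n\<close> is a finitely supported map from
  exponent vectors to coefficients.
\<close>

definition eval_mpoly ::
  "(('n::finite \<Rightarrow>\<^sub>0 nat) \<Rightarrow>\<^sub>0 'k::field) \<Rightarrow> 'k alg_closure ^ 'n \<Rightarrow> 'k alg_closure" where
  "eval_mpoly f z =
     (\<Sum>m\<in>Poly_Mapping.keys f.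
        to_ac (Poly_Mapping.lookup f m) * (\<Prod>i\<in>UNIV. (z $ i) ^ Poly_Mapping.lookup m i))"

text \<open>Irreducibility is not required, and the defining set of polynomials is arbitrary.\<close>

definition subvariety_over_base :: "('k::field alg_closure ^ 'n::finite) set \<Rightarrow> bool" where
  "subvariety_over_base V \<longleftrightarrow>
     (\<exists>S :: (('n \<Rightarrow>\<^sub>0 nat) \<Rightarrow>\<^sub>0 'k) set. V = {z. \<forall>f\<in>S. eval_mpoly f z = 0})"

definition is_coset_in ::
  "('n::finite \<Rightarrow> 'f::{finite,field} poly \<Rightarrow> 'k::field poly) \<Rightarrow>
     ('k alg_closure ^ 'n) set \<Rightarrow> ('k alg_closure ^ 'n) set \<Rightarrow> bool" where
  "is_coset_in \<phi> \<Gamma> C \<longleftrightarrow> (\<exists>c\<in>\<Gamma>. \<exists>H. is_submodule \<phi> H \<and> H \<subseteq> \<Gamma> \<and> C = (\<lambda>h. c + h) ` H)"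

end

theory Submission
  imports Defs
begin

text \<open>
  The proof is the Skolem--Mahler--Lech method. An orbit map \<open>a \<mapsto> \<phi>\<^sub>a(y)\<close> is turned into a
  power series in \<open>a\<close> that converges on all of \<open>A\<close>, for the topology of a suitable prime \<open>P\<close> of
  \<open>A\<close>; such a series has finitely many zeros or vanishes identically.

  \<^emph>\<open>The prime.\<close> Finitely many elements of \<open>K\<close> matter: the coordinates of the generator, the
  coefficients of the \<open>\<phi>\<^sub>i(t)\<close> and of the \<open>\<phi>\<^sub>i(\<alpha>)\<close> for constants \<open>\<alpha>\<close>. Express them, \<open>1\<close>, the
  elements of a basis of \<open>K\<close> over \<open>F\<^sub>q(t)\<close> and their products in that basis, and choose \<open>P\<close>
  prime to all the denominators. The elements of \<open>K\<close> whose coordinates lie in the local ring of \<open>A\<close>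
  at \<open>P\<close> then form a ring \<open>R\<close> that contains all these data (lemma \<open>exists_adic_ring\<close>). The
  ideals \<open>P\<^sup>M R\<close> play the part of a valuation on \<open>K\<close>, and congruences modulo all of them the part of
  its completion.

  \<^emph>\<open>Analyticity.\<close> Let \<open>C\<^sub>j(a)\<close> be the coefficient of \<open>\<tau>\<^sup>j\<close> in \<open>\<phi>\<^sub>a\<close>. Comparing coefficients in
  \<open>\<phi>\<^sub>a \<phi>\<^sub>t = \<phi>\<^sub>t \<phi>\<^sub>a\<close> gives a recursion which shows that \<open>C\<^sub>j(a)\<close> is a polynomial in \<open>a\<close>, whose
  denominators come from division by \<open>t^(q^j) - t\<close>. As that polynomial is squarefree, \<open>P\<close> enters
  with exponent less than \<open>q^j\<close> in the denominators of \<open>C\<^sub>j\<close>. If \<open>y\<close> is divisible by \<open>P\<^sup>2\<close>, then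
  \<open>\<phi>\<^sub>a(y) = \<Sum>\<^sub>j C\<^sub>j(a) y^(q^j)\<close> therefore converges \<open>P\<close>-adically as a power series in \<open>a\<close> with
  coefficients in \<open>R\<close> (\<open>drinfeld_orbit_analytic\<close>).

  \<^emph>\<open>Conclusion.\<close> Since \<open>R / P\<^sup>2 R\<close> is finite, some nonzero \<open>b\<close> makes every coordinate of \<open>\<phi>\<^sub>b(x)\<close> divisible by
  \<open>P\<^sup>2\<close>, where \<open>x\<close> is the generator.
  For a polynomial \<open>f\<close> vanishing on \<open>V\<close> and for fixed \<open>c\<close>, the function
  \<open>a \<mapsto> f(\<phi>\<^sub>c(x) + \<phi>\<^sub>a(\<phi>\<^sub>b(x)))\<close> is analytic, so by Strassmann's theorem (\<open>strassmann\<close>) it has finitely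
  many zeros or is zero. Hence \<open>V\<close> meets each of the finitely many cosets
  \<open>\<phi>\<^sub>c(x) + {\<phi>\<^sub>a(\<phi>\<^sub>b(x)) | a \<in> A}\<close>, where \<open>c\<close> runs through the residues modulo \<open>b\<close>, in a finite set
  or in the whole coset.
\<close>

section \<open>The Frobenius map and composition of additive polynomials\<close>

lemma finite_field_power_CARD:
  fixes x :: "'f::{finite,field}"
  shows "x ^ CARD('f) = x"
proof (cases "x = 0")
  case True
  then show ?thesis by (simp add: zero_power)
next
  case False
  have bij: "bij_betw ((*) x) (UNIV - {0}) (UNIV - {0})"
    by (rule bij_betwI[where g = "\<lambda>y. y / x"]) (use False in auto)
  have "(\<Prod>y\<in>UNIV - {0}. x * y) = \<Prod>(UNIV - {0})"
    using prod.reindex_bij_betw[OF bij, of "\<lambda>y. y"] by simp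
  then have "x ^ (CARD('f) - 1) * \<Prod>(UNIV - {0}) = \<Prod>(UNIV - {0 :: 'f})"
    by (simp add: prod.distrib card_Diff_subset)
  then have "x ^ (CARD('f) - 1) = 1"
    by (simp add: prod_zero_iff)
  then have "x * x ^ (CARD('f) - 1) = x" by simp
  then show ?thesis
    by (metis power_Suc Suc_diff_1 zero_less_card_finite)
qed

lemma CARD_field_ge_2: "CARD('f::{finite,field}) \<ge> 2"
proof -
  have "card {0, 1 :: 'f} \<le> CARD('f)" by (rule card_mono) auto
  then show ?thesis by simp
qed

text \<open>
  The polynomial \<open>(X + 1)^q - X^q - 1\<close> has degree less than \<open>q\<close> but vanishes at all \<open>q\<close> elements of the
  field, so it is zero. Additivity of \<open>x \<mapsto> x^q\<close> in every ring containing the field follows.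
\<close>

lemma of_nat_CARD_choose_eq_0:
  assumes "0 < k" "k < CARD('f)"
  shows "of_nat (CARD('f) choose k) = (0 :: 'f::{finite,field})"
proof -
  let ?q = "CARD('f)"
  define D :: "'f poly" where "D = [:1, 1:] ^ ?q - monom 1 ?q - 1"
  have cf: "coeff ([:1, 1 :: 'f:] ^ n) k = of_nat (n choose k)" for n k
  proof -
    have "[:1, 1 :: 'f:] ^ n = (monom 1 1 + 1) ^ n"
      by (simp add: monom_altdef one_pCons)
    also have "\<dots> = (\<Sum>i\<le>n. monom (of_nat (n choose i)) i)"
      by (subst binomial_ring) (simp add: monom_power of_nat_poly smult_monom)
    finally show ?thesis
      by (auto simp: coeff_sum binomial_eq_0)
  qed
  have D0: "coeff D m = 0" if "m \<ge> ?q" for m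
    using that CARD_field_ge_2[where 'f = 'f] by (auto simp: D_def cf binomial_eq_0 coeff_1)
  have "D = 0"
  proof (rule ccontr)
    assume nz: "D \<noteq> 0"
    have "poly D z = 0" for z
      by (simp add: D_def poly_monom finite_field_power_CARD)
    then have "{z. poly D z = 0} = UNIV" by auto
    then have "?q \<le> degree D"
      using card_poly_roots_bound[OF nz] by simp
    then have "lead_coeff D = 0" using D0 by blast
    then show False using nz by simp
  qed
  then have "coeff D k = 0" by simp
  then show ?thesis using assms by (simp add: D_def cf coeff_1)
qed

text \<open>
  The assumption says that the characteristic of the ring divides that of \<open>F\<^sub>q\<close>; the lemma is used in
  \<open>K[X]\<close>, where the inner factor of a composition is raised to the power \<open>q\<^sup>n\<close>.
\<close>

lemma power_add_CARD_power:
  fixes x y :: "'r::comm_ring_1"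
  assumes "\<And>k. of_nat k = (0 :: 'f::{finite,field}) \<Longrightarrow> of_nat k = (0 :: 'r)"
  shows "(x + y) ^ (CARD('f) ^ n) = x ^ (CARD('f) ^ n) + y ^ (CARD('f) ^ n)"
proof -
  let ?q = "CARD('f)"
  have one: "(x + y) ^ ?q = x ^ ?q + y ^ ?q" for x y :: 'r
  proof -
    have "(x + y) ^ ?q = (\<Sum>k\<le>?q. of_nat (?q choose k) * x ^ k * y ^ (?q - k))"
      by (rule binomial_ring)
    also have "\<dots> = (\<Sum>k\<in>{0,?q}. of_nat (?q choose k) * x ^ k * y ^ (?q - k))"
    proof (intro sum.mono_neutral_right ballI)
      fix k assume "k \<in> {..?q} - {0, ?q}"
      then have "of_nat (?q choose k) = (0 :: 'r)"
        by (intro assms of_nat_CARD_choose_eq_0) auto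
      then show "of_nat (?q choose k) * x ^ k * y ^ (?q - k) = 0" by simp
    qed auto
    finally show ?thesis by simp
  qed
  show ?thesis
  proof (induction n)
    case (Suc n)
    have "(x + y) ^ (?q ^ Suc n) = ((x + y) ^ (?q ^ n)) ^ ?q"
      by (simp add: power_mult[symmetric] mult.commute)
    also have "\<dots> = (x ^ (?q ^ n)) ^ ?q + (y ^ (?q ^ n)) ^ ?q"
      by (simp add: Suc one)
    finally show ?case by (simp add: power_mult[symmetric] mult.commute)
  qed simp
qed

lemma power_sum_CARD_power:
  fixes f :: "'i \<Rightarrow> 'r::comm_ring_1"
  assumes "\<And>k. of_nat k = (0 :: 'f::{finite,field}) \<Longrightarrow> of_nat k = (0 :: 'r)"
  shows "(\<Sum>i\<in>I. f i) ^ (CARD('f) ^ n) = (\<Sum>i\<in>I. f i ^ (CARD('f) ^ n))"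
  by (induction I rule: infinite_finite_induct)
    (simp_all add: power_add_CARD_power[where 'f = 'f, OF assms] zero_power)

text \<open>
  Stated for all large \<open>m\<close> so that two twisted polynomials can be expanded up to a common bound.
\<close>

lemma twisted_polys_eq_sum:
  fixes Q :: "'k::field poly"
  assumes "Q \<in> twisted_polys q" "q \<ge> 2"
  shows "\<exists>n. \<forall>m\<ge>n. Q = (\<Sum>k\<le>m. monom (coeff Q (q ^ k)) (q ^ k))"
proof -
  obtain n c where Q: "Q = (\<Sum>j\<le>n. monom (c j) (q ^ j))"
    using assms(1) by (auto simp: twisted_polys_def)
  have cf: "coeff Q (q ^ k) = (if k \<le> n then c k else 0)" for k
  proof -
    have "coeff Q (q ^ k) = (\<Sum>j\<le>n. if j = k then c j else 0)"
      using assms(2) by (auto simp: Q coeff_sum intro!: sum.cong)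
    then show ?thesis by simp
  qed
  have "Q = (\<Sum>k\<le>m. monom (coeff Q (q ^ k)) (q ^ k))" if "m \<ge> n" for m
  proof -
    have "(\<Sum>k\<le>m. monom (coeff Q (q ^ k)) (q ^ k)) = (\<Sum>k\<le>n. monom (c k) (q ^ k))"
      using that by (intro sum.mono_neutral_cong_right) (auto simp: cf)
    then show ?thesis by (simp add: Q)
  qed
  then show ?thesis by blast
qed

text \<open>
  This is the multiplication rule \<open>\<tau>\<^sup>k d = d^(q^k) \<tau>\<^sup>k\<close> of \<open>K{\<tau>}\<close>, read off from the composition of
  the additive polynomials.
\<close>

lemma coeff_twisted_pcompose:
  fixes Q S :: "'k::field poly"
  assumes char: "\<And>k. of_nat k = (0 :: 'f::{finite,field}) \<Longrightarrow> of_nat k = (0 :: 'k)"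
  assumes Q: "Q \<in> twisted_polys CARD('f)" and S: "S \<in> twisted_polys CARD('f)"
  shows "coeff (pcompose Q S) (CARD('f) ^ j) =
           (\<Sum>k\<le>j. coeff Q (CARD('f) ^ k) * coeff S (CARD('f) ^ (j - k)) ^ (CARD('f) ^ k))"
proof -
  let ?q = "CARD('f)"
  note q2 = CARD_field_ge_2[where 'f = 'f]
  obtain n where n: "\<And>m. m \<ge> n \<Longrightarrow> Q = (\<Sum>k\<le>m. monom (coeff Q (?q ^ k)) (?q ^ k))"
    using twisted_polys_eq_sum[OF Q q2] by blast
  obtain n' where n': "\<And>m. m \<ge> n' \<Longrightarrow> S = (\<Sum>k\<le>m. monom (coeff S (?q ^ k)) (?q ^ k))"
    using twisted_polys_eq_sum[OF S q2] by blast
  define m where "m = max j (max n n')"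
  define c where "c k = coeff Q (?q ^ k)" for k
  define d where "d k = coeff S (?q ^ k)" for k
  have Qm: "Q = (\<Sum>k\<le>m. monom (c k) (?q ^ k))" unfolding c_def by (rule n) (simp add: m_def)
  have Sm: "S = (\<Sum>k\<le>m. monom (d k) (?q ^ k))" unfolding d_def by (rule n') (simp add: m_def)
  have charp: "of_nat k = (0 :: 'k poly)" if "of_nat k = (0 :: 'f)" for k
    using char[OF that] by (simp add: of_nat_poly)
  have Spow: "S ^ (?q ^ k) = (\<Sum>i\<le>m. monom (d i ^ (?q ^ k)) (?q ^ (i + k)))" for k
    by (subst Sm, subst power_sum_CARD_power[where 'f = 'f, OF charp])
      (simp_all add: monom_power power_add)
  have pcompose_power: "pcompose (A ^ n) S = pcompose A S ^ n" for A n
    by (induction n) (simp_all add: pcompose_mult pcompose_1)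
  have comp: "pcompose (\<Sum>k\<in>I. monom (c k) (?q ^ k)) S = (\<Sum>k\<in>I. smult (c k) (S ^ (?q ^ k)))" for I :: "nat set"
    by (simp add: pcompose_sum monom_altdef pcompose_smult pcompose_power pcompose_pCons)
  have "coeff (pcompose Q S) (?q ^ j) =
      (\<Sum>k\<le>m. \<Sum>i\<le>m. if i + k = j then c k * d i ^ (?q ^ k) else 0)"
    by (subst Qm, subst comp) (use q2 in \<open>auto simp: coeff_sum Spow sum_distrib_left intro!: sum.cong\<close>)
  also have "\<dots> = (\<Sum>k\<le>m. if k \<le> j then c k * d (j - k) ^ (?q ^ k) else 0)"
  proof (intro sum.cong refl)
    fix k assume "k \<in> {..m}"
    have "(\<Sum>i\<le>m. if i + k = j then c k * d i ^ (?q ^ k) else 0) =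
        (\<Sum>i\<in>(if k \<le> j then {j - k} else {}). c k * d i ^ (?q ^ k))"
      by (rule sum.mono_neutral_cong_right) (auto simp: m_def split: if_splits)
    then show "(\<Sum>i\<le>m. if i + k = j then c k * d i ^ (?q ^ k) else 0) =
        (if k \<le> j then c k * d (j - k) ^ (?q ^ k) else 0)" by auto
  qed
  also have "\<dots> = (\<Sum>k\<le>j. c k * d (j - k) ^ (?q ^ k))"
    by (rule sum.mono_neutral_cong_right) (auto simp: m_def)
  finally show ?thesis by (simp add: c_def d_def)
qed

section \<open>Analytic functions over an adic ring and the theorem of Strassmann\<close>

text \<open>
  These are the properties of \<open>P\<close>-adic integers that the analysis uses. In an absorbing ring every
  element of the field becomes integral after multiplication by a power of \<open>\<pi>\<close>; separatedness says that
  only \<open>0\<close> is divisible by all powers of \<open>\<pi>\<close>. Several places of \<open>K\<close> may lie above \<open>P\<close>, so the intended \<open>R\<close> can have several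
  maximal ideals, and \<open>\<pi> R\<close> can fail to be prime.
\<close>

locale adic_ring =
  fixes R :: "'k::field set" and \<pi> :: 'k
  assumes zero_mem: "0 \<in> R" and one_mem: "1 \<in> R"
    and add_mem: "x \<in> R \<Longrightarrow> y \<in> R \<Longrightarrow> x + y \<in> R"
    and uminus_mem: "x \<in> R \<Longrightarrow> - x \<in> R"
    and mult_mem: "x \<in> R \<Longrightarrow> y \<in> R \<Longrightarrow> x * y \<in> R"
    and unif_mem: "\<pi> \<in> R"
    and unif_nonzero: "\<pi> \<noteq> 0"
    and separated: "(\<And>M. z / \<pi> ^ M \<in> R) \<Longrightarrow> z = 0"
    and absorbing: "\<exists>h. \<pi> ^ h * z \<in> R"
begin

definition filt :: "nat \<Rightarrow> 'k set" where
  "filt M = {z. z / \<pi> ^ M \<in> R}"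

definition polys :: "nat \<Rightarrow> 'k poly set" where
  "polys M = {g. \<forall>k. coeff g k \<in> filt M}"

lemma unif_power_nonzero [simp]: "\<pi> ^ M \<noteq> 0"
  using unif_nonzero by simp

lemma power_mem: "x \<in> R \<Longrightarrow> x ^ n \<in> R"
  by (induction n) (auto intro: one_mem mult_mem)

lemma filt_0 [simp]: "filt 0 = R"
  by (simp add: filt_def)

lemma filt_zero [simp]: "0 \<in> filt M"
  by (simp add: filt_def zero_mem)

lemma filt_add: "x \<in> filt M \<Longrightarrow> y \<in> filt M \<Longrightarrow> x + y \<in> filt M"
  by (simp add: filt_def add_mem add_divide_distrib)

lemma filt_uminus: "x \<in> filt M \<Longrightarrow> - x \<in> filt M"
  using uminus_mem[of "x / \<pi> ^ M"] by (simp add: filt_def)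

lemma filt_diff: "x \<in> filt M \<Longrightarrow> y \<in> filt M \<Longrightarrow> x - y \<in> filt M"
  using filt_add[of x M "- y"] filt_uminus by simp

lemma filt_sum: "(\<And>i. i \<in> I \<Longrightarrow> f i \<in> filt M) \<Longrightarrow> (\<Sum>i\<in>I. f i) \<in> filt M"
  by (induction I rule: infinite_finite_induct) (auto intro: filt_add)

lemma filt_mult: "x \<in> filt M \<Longrightarrow> y \<in> filt N \<Longrightarrow> x * y \<in> filt (M + N)"
  using mult_mem[of "x / \<pi> ^ M" "y / \<pi> ^ N"] by (simp add: filt_def power_add)

lemma filt_mult_left: "x \<in> R \<Longrightarrow> y \<in> filt M \<Longrightarrow> x * y \<in> filt M"
  using filt_mult[of x 0 y M] by simp

lemma filt_power: "x \<in> filt M \<Longrightarrow> x ^ n \<in> filt (M * n)"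
  by (induction n) (auto simp: one_mem dest: filt_mult)

lemma filt_antimono:
  assumes "x \<in> filt N" "M \<le> N"
  shows "x \<in> filt M"
proof -
  have "\<pi> ^ (N - M) * (x / \<pi> ^ N) \<in> R"
    using assms(1) by (intro mult_mem power_mem unif_mem) (simp add: filt_def)
  also have "\<pi> ^ (N - M) * (x / \<pi> ^ N) = x / \<pi> ^ M"
    using assms(2) by (simp add: power_diff unif_nonzero)
  finally show ?thesis by (simp add: filt_def)
qed

lemma filt_divide: "x \<in> filt (M + h) \<Longrightarrow> x / \<pi> ^ h \<in> filt M"
  by (simp add: filt_def power_add mult.commute)

lemma polys_zero [simp]: "0 \<in> polys M"
  by (simp add: polys_def)

lemma polys_add: "f \<in> polys M \<Longrightarrow> g \<in> polys M \<Longrightarrow> f + g \<in> polys M"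
  by (simp add: polys_def filt_add)

lemma polys_diff: "f \<in> polys M \<Longrightarrow> g \<in> polys M \<Longrightarrow> f - g \<in> polys M"
  by (simp add: polys_def filt_diff)

lemma polys_sum: "(\<And>i. i \<in> I \<Longrightarrow> f i \<in> polys M) \<Longrightarrow> (\<Sum>i\<in>I. f i) \<in> polys M"
  by (induction I rule: infinite_finite_induct) (auto intro: polys_add)

lemma polys_mult: "f \<in> polys M \<Longrightarrow> g \<in> polys N \<Longrightarrow> f * g \<in> polys (M + N)"
  by (simp add: polys_def coeff_mult filt_mult filt_sum)

lemma polys_antimono: "f \<in> polys N \<Longrightarrow> M \<le> N \<Longrightarrow> f \<in> polys M"
  using filt_antimono by (auto simp: polys_def)

lemma polys_smult: "c \<in> filt M \<Longrightarrow> f \<in> polys N \<Longrightarrow> smult c f \<in> polys (M + N)"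
  by (simp add: polys_def filt_mult)

lemma polys_smult_mem: "c \<in> R \<Longrightarrow> f \<in> polys M \<Longrightarrow> smult c f \<in> polys M"
  using polys_smult[of c 0 f M] by simp

lemma polys_const: "c \<in> R \<Longrightarrow> [:c:] \<in> polys 0"
  by (auto simp: polys_def coeff_pCons zero_mem split: nat.split)

lemma polys_one: "1 \<in> polys 0"
  using polys_const[OF one_mem] by (simp add: one_pCons)

lemma polys_power: "f \<in> polys M \<Longrightarrow> f ^ n \<in> polys (M * n)"
  by (induction n) (auto simp: polys_one dest: polys_mult)

lemma poly_mem_filt: "f \<in> polys M \<Longrightarrow> x \<in> R \<Longrightarrow> poly f x \<in> filt M"
  unfolding poly_altdef polys_def
  using filt_mult[of _ M _ 0] by (intro filt_sum) (auto simp: power_mem)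

text \<open>
  A function of \<open>a\<close> is analytic if it is given by a power series \<open>\<Sum>\<^sub>k s\<^sub>k e(a)^k\<close> whose coefficients lie in
  the \<open>\<pi>\<close>-adic completion of \<open>R\<close> and tend to \<open>0\<close>. The polynomial \<open>g M\<close> is this series modulo
  \<open>\<pi>^M\<close>, which avoids the completion. The compatibility of \<open>g M\<close> and \<open>g (Suc M)\<close> is required of the
  coefficients; if only values were compared, locally constant functions would be included and
  Strassmann's theorem would fail.
\<close>

definition analytic :: "('x \<Rightarrow> 'k) \<Rightarrow> ('x \<Rightarrow> 'k) \<Rightarrow> bool" where
  "analytic e F \<longleftrightarrow> (\<exists>g. (\<forall>M. g M \<in> polys 0) \<and> (\<forall>M. g (Suc M) - g M \<in> polys M) \<and>
     (\<forall>a M. F a - poly (g M) (e a) \<in> filt M))"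

lemma analytic_const: "c \<in> R \<Longrightarrow> analytic e (\<lambda>_. c)"
  unfolding analytic_def by (intro exI[of _ "\<lambda>_. [:c:]"]) (simp add: polys_const)

lemma analytic_add:
  assumes "analytic e F" "analytic e G"
  shows "analytic e (\<lambda>a. F a + G a)"
proof -
  obtain f where f: "\<And>M. f M \<in> polys 0" "\<And>M. f (Suc M) - f M \<in> polys M"
      "\<And>a M. F a - poly (f M) (e a) \<in> filt M"
    using assms(1) by (auto simp: analytic_def)
  obtain g where g: "\<And>M. g M \<in> polys 0" "\<And>M. g (Suc M) - g M \<in> polys M"
      "\<And>a M. G a - poly (g M) (e a) \<in> filt M"
    using assms(2) by (auto simp: analytic_def)
  show ?thesis unfolding analytic_def
  proof (intro exI[of _ "\<lambda>M. f M + g M"] conjI allI)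
    show "f M + g M \<in> polys 0" for M by (intro polys_add f g)
    show "f (Suc M) + g (Suc M) - (f M + g M) \<in> polys M" for M
      using polys_add[OF f(2) g(2), of M] by (simp add: algebra_simps)
    show "F a + G a - poly (f M + g M) (e a) \<in> filt M" for a M
      using filt_add[OF f(3) g(3), of a M a] by (simp add: algebra_simps)
  qed
qed

lemma analytic_mult:
  assumes "analytic e F" "analytic e G" and e: "\<And>a. e a \<in> R"
  shows "analytic e (\<lambda>a. F a * G a)"
proof -
  obtain f where f: "\<And>M. f M \<in> polys 0" "\<And>M. f (Suc M) - f M \<in> polys M"
      "\<And>a M. F a - poly (f M) (e a) \<in> filt M"
    using assms(1) by (auto simp: analytic_def)
  obtain g where g: "\<And>M. g M \<in> polys 0" "\<And>M. g (Suc M) - g M \<in> polys M"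
      "\<And>a M. G a - poly (g M) (e a) \<in> filt M"
    using assms(2) by (auto simp: analytic_def)
  have GR: "G a \<in> R" for a
    using filt_add[OF g(3)[of a 0] poly_mem_filt[OF g(1)[of 0] e[of a]]] by simp
  show ?thesis unfolding analytic_def
  proof (intro exI[of _ "\<lambda>M. f M * g M"] conjI allI)
    show "f M * g M \<in> polys 0" for M using polys_mult[OF f(1) g(1)] by simp
    show "f (Suc M) * g (Suc M) - f M * g M \<in> polys M" for M
      using polys_add[OF polys_mult[OF f(2)[of M] g(1)[of "Suc M"], unfolded add_0_right]
          polys_mult[OF f(1)[of M] g(2)[of M], unfolded add_0]]
      by (simp add: algebra_simps)
    show "F a * G a - poly (f M * g M) (e a) \<in> filt M" for a M
    proof -
      have "(F a - poly (f M) (e a)) * G a \<in> filt M"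
        using filt_mult[OF f(3)[of a M], of "G a" 0] GR by simp
      moreover have "poly (f M) (e a) * (G a - poly (g M) (e a)) \<in> filt M"
        using filt_mult[OF poly_mem_filt[OF f(1)[of M] e[of a]] g(3)[of a M]] by simp
      ultimately show ?thesis
        using filt_add by (fastforce simp: algebra_simps)
    qed
  qed
qed

lemma analytic_power:
  assumes "analytic e F" "\<And>a. e a \<in> R"
  shows "analytic e (\<lambda>a. F a ^ n)"
  by (induction n) (simp_all add: analytic_const one_mem analytic_mult assms)

lemma analytic_sum:
  assumes "\<And>i. i \<in> I \<Longrightarrow> analytic e (F i)"
  shows "analytic e (\<lambda>a. \<Sum>i\<in>I. F i a)"
  using assms
  by (induction I rule: infinite_finite_induct) (simp_all add: analytic_const zero_mem analytic_add)

lemma analytic_prod: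
  assumes "\<And>i. i \<in> I \<Longrightarrow> analytic e (F i)" "\<And>a. e a \<in> R"
  shows "analytic e (\<lambda>a. \<Prod>i\<in>I. F i a)"
  using assms
  by (induction I rule: infinite_finite_induct) (simp_all add: analytic_const one_mem analytic_mult)

text \<open>
  The coefficient of \<open>X^k\<close> in the quotient is a combination of the coefficients of \<open>g\<close> of degree
  greater than \<open>k\<close>. So dividing out a zero lowers by one the degree beyond which all
  coefficients are divisible by \<open>\<pi>\<close>, the quantity on which the next lemma is an induction.
\<close>

lemma synthetic_div_coeff_mem_filt:
  assumes c: "c \<in> R" and g: "\<And>k. k > n \<Longrightarrow> coeff g k \<in> filt M" and "k \<ge> n"
  shows "coeff (synthetic_div g c) k \<in> filt M"
proof -
  let ?h = "synthetic_div g c"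
  have rec: "coeff g (Suc k) = coeff ?h k - c * coeff ?h (Suc k)" for k
    by (subst synthetic_div_correct'[of c g, symmetric]) simp
  have "\<And>k. degree ?h < k + d \<Longrightarrow> n \<le> k \<Longrightarrow> coeff ?h k \<in> filt M" for d
  proof (induction d)
    case 0
    then show ?case by (simp add: coeff_eq_0)
  next
    case (Suc d)
    have "coeff ?h (Suc k) \<in> filt M" by (rule Suc.IH) (use Suc.prems in auto)
    then have "coeff g (Suc k) + c * coeff ?h (Suc k) \<in> filt M"
      using Suc.prems by (intro filt_add filt_mult_left c g) auto
    then show ?case by (simp add: rec)
  qed
  from this[of k "Suc (degree ?h)"] show ?thesis using \<open>k \<ge> n\<close> by simp
qed

text \<open>
  The finite-level form of Strassmann's bound. A polynomial whose reduction modulo \<open>\<pi>\<close> has degree exactly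
  \<open>N\<close> cannot have \<open>N + 1\<close> given points as approximate zeros of too high a precision \<open>D\<close>, and \<open>D\<close> depends
  on the points only, hence serves all the approximations of a power series at once. In the induction, a
  zero \<open>c\<close> is divided out; the precision lost at another point \<open>a\<close> is the power of \<open>\<pi>\<close> that clears the
  denominator of \<open>1 / (a - c)\<close>.
\<close>

lemma few_approximate_zeros:
  assumes "finite S" "S \<subseteq> R" "card S > N"
  shows "\<exists>D. \<forall>g\<in>polys 0. coeff g N \<notin> filt 1 \<longrightarrow> (\<forall>k>N. coeff g k \<in> filt 1) \<longrightarrow>
           (\<exists>a\<in>S. poly g a \<notin> filt D)"
  using assms
proof (induction N arbitrary: S)
  case 0
  then obtain a where a: "a \<in> S" by fastforce
  show ?case
  proof (intro exI[of _ 1] ballI impI bexI[OF _ a] notI)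
    fix g assume g: "g \<in> polys 0" "coeff g 0 \<notin> filt 1" "\<forall>k>0. coeff g k \<in> filt 1"
      and v: "poly g a \<in> filt 1"
    obtain c h where gc: "g = pCons c h" by (cases g) auto
    have "h \<in> polys 1"
      unfolding polys_def
    proof (intro CollectI allI)
      fix k show "coeff h k \<in> filt 1" using g(3)[rule_format, of "Suc k"] by (simp add: gc)
    qed
    then have "poly g a - a * poly h a \<in> filt 1"
      using a 0 by (intro filt_diff v filt_mult_left poly_mem_filt) auto
    then show False using g(2) by (simp add: gc)
  qed
next
  case (Suc N)
  then obtain c where c: "c \<in> S" by fastforce
  have cR: "c \<in> R" using c Suc.prems by auto
  have card: "card (S - {c}) > N" using Suc.prems c by (simp add: card_Diff_singleton)
  obtain D where D: "\<And>g. g \<in> polys 0 \<Longrightarrow> coeff g N \<notin> filt 1 \<Longrightarrow> (\<forall>k>N. coeff g k \<in> filt 1) \<Longrightarrow>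
      \<exists>a\<in>S - {c}. poly g a \<notin> filt D"
    using Suc.IH[OF _ _ card] Suc.prems by (metis Diff_subset finite_Diff subset_trans)
  \<comment> \<open>The number of digits lost at \<open>a\<close> when \<open>a - c\<close> is divided out.\<close>
  define h where "h a = (SOME h. \<pi> ^ h * inverse (a - c) \<in> R)" for a
  have h: "\<pi> ^ h a * inverse (a - c) \<in> R" for a
    unfolding h_def by (rule someI_ex[OF absorbing])
  define H where "H = (\<Sum>a\<in>S. h a)"
  show ?case
  proof (intro exI[of _ "D + H"] ballI impI, rule ccontr)
    fix g assume g: "g \<in> polys 0" "coeff g (Suc N) \<notin> filt 1" "\<forall>k>Suc N. coeff g k \<in> filt 1"
      and "\<not> (\<exists>a\<in>S. poly g a \<notin> filt (D + H))"
    then have v: "\<And>a. a \<in> S \<Longrightarrow> poly g a \<in> filt (D + H)" by auto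
    define f where "f = synthetic_div g c"
    have gf: "g = [:- c, 1:] * f + [:poly g c:]"
      unfolding f_def by (rule synthetic_div_correct'[symmetric])
    have f0: "f \<in> polys 0"
      using synthetic_div_coeff_mem_filt[OF cR, of 0 g 0] g(1) by (auto simp: f_def polys_def)
    have f1: "\<forall>k>N. coeff f k \<in> filt 1"
      using synthetic_div_coeff_mem_filt[OF cR, of "Suc N" g 1] g(3) by (auto simp: f_def)
    have "coeff g (Suc N) = coeff f N - c * coeff f (Suc N)" by (subst gf) simp
    then have "coeff f N \<notin> filt 1"
      using g(2) filt_diff[OF _ filt_mult_left[OF cR f1[rule_format, of "Suc N"]]] by force
    then obtain a where a: "a \<in> S" "a \<noteq> c" "poly f a \<notin> filt D"
      using D[OF f0 _ f1] by auto
    have "poly g a = (a - c) * poly f a + poly g c"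
      by (subst gf) (simp add: algebra_simps)
    then have fa: "poly f a = (poly g a - poly g c) * inverse (a - c)"
      using a(2) by (simp add: field_simps)
    have "h a \<le> H" unfolding H_def using a(1) Suc.prems(1) by (simp add: member_le_sum)
    then have "poly g a - poly g c \<in> filt (D + h a)"
      using filt_antimono[OF filt_diff[OF v[OF a(1)] v[OF c]]] by simp
    then have "(poly g a - poly g c) / \<pi> ^ h a \<in> filt D" by (rule filt_divide)
    from filt_mult[OF this, of "\<pi> ^ h a * inverse (a - c)" 0] h
    have "poly f a \<in> filt D" by (simp add: fa unif_nonzero)
    with a(3) show False ..
  qed
qed

text \<open>
  If some \<open>g M\<close> is not divisible by \<open>\<pi>^M\<close>, divide the series by the largest power \<open>\<pi>^h\<close> that divides all its
  coefficients. The reduction modulo \<open>\<pi>\<close> of the quotient is a fixed nonzero polynomial, of degree \<open>N\<close> say,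
  and more than \<open>N\<close> zeros contradict the preceding lemma as the approximation improves. Otherwise the values
  are divisible by every power of \<open>\<pi>\<close>, and the ring is separated.
\<close>

theorem strassmann:
  assumes F: "analytic e F" and e: "inj e" "\<And>a. e a \<in> R" and inf: "infinite {a. F a = 0}"
  shows "F a = 0"
proof -
  obtain g where g: "\<And>M. g M \<in> polys 0" "\<And>M. g (Suc M) - g M \<in> polys M"
      "\<And>a M. F a - poly (g M) (e a) \<in> filt M"
    using F by (auto simp: analytic_def)
  have cauchy: "g M' - g M \<in> polys M" if "M' \<ge> M" for M M'
    using that
  proof (induction rule: dec_induct)
    case (step n)
    have "(g (Suc n) - g n) + (g n - g M) \<in> polys M"
      using step by (intro polys_add polys_antimono[OF g(2)[of n]]) auto
    then show ?case by simp
  qed simp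
  have gM: "g M \<in> polys M" for M
  proof (rule ccontr)
    assume M: "g M \<notin> polys M"
    define h where "h = Max {h. h < M \<and> g M \<in> polys h}"
    have fin: "finite {h. h < M \<and> g M \<in> polys h}" by simp
    have "0 \<in> {h. h < M \<and> g M \<in> polys h}" using M g(1)[of M] by (cases M) auto
    then have "h \<in> {h. h < M \<and> g M \<in> polys h}" unfolding h_def using fin Max_in by blast
    then have h: "h < M" "g M \<in> polys h" by auto
    have h': "g M \<notin> polys (Suc h)"
    proof
      assume A: "g M \<in> polys (Suc h)"
      show False
      proof (cases "Suc h < M")
        case True
        then have "Suc h \<le> h" using A Max_ge[OF fin, of "Suc h"] by (simp add: h_def)
        then show False by simp
      next
        case False
        then show False using A M h(1) by (metis Suc_lessI)
      qed
    qed
    define N where "N = Max {k. coeff (g M) k \<notin> filt (Suc h)}"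
    have finN: "finite {k. coeff (g M) k \<notin> filt (Suc h)}"
      by (rule finite_subset[of _ "{..degree (g M)}"]) (auto intro!: leI simp: coeff_eq_0)
    have "{k. coeff (g M) k \<notin> filt (Suc h)} \<noteq> {}" using h' by (auto simp: polys_def)
    then have N: "coeff (g M) N \<notin> filt (Suc h)" unfolding N_def using finN Max_in by blast
    have N': "coeff (g M) k \<in> filt (Suc h)" if "k > N" for k
      using that finN Max_ge[OF finN, of k] by (auto simp: N_def not_le[symmetric])
    obtain S where S: "S \<subseteq> {a. F a = 0}" "finite S" "card S = Suc N"
      using infinite_arbitrarily_large[OF inf] by blast
    have "card (e ` S) = Suc N" using S e(1) by (simp add: card_image inj_on_subset)
    then obtain D where D: "\<And>f. f \<in> polys 0 \<Longrightarrow> coeff f N \<notin> filt 1 \<Longrightarrow> \<forall>k>N. coeff f k \<in> filt 1 \<Longrightarrow>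
        \<exists>a\<in>e ` S. poly f a \<notin> filt D"
      using few_approximate_zeros[of "e ` S" N] S(2) e(2)
      by (metis finite_imageI image_subsetI lessI)
    \<comment> \<open>Precise enough to keep \<open>D\<close> digits after the division by \<open>\<pi>^h\<close>.\<close>
    define M' where "M' = max M (D + h)"
    define f where "f = smult (1 / \<pi> ^ h) (g M')"
    have dif: "g M' - g M \<in> polys (Suc h)"
      by (rule polys_antimono[OF cauchy]) (use h in \<open>auto simp: M'_def\<close>)
    have gh: "g M' \<in> polys h"
      using polys_add[OF h(2) polys_antimono[OF dif, of h]] by simp
    have iff: "coeff f k \<in> filt 1 \<longleftrightarrow> coeff (g M) k \<in> filt (Suc h)" for k
    proof -
      have "coeff f k \<in> filt 1 \<longleftrightarrow> coeff (g M') k \<in> filt (Suc h)"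
        by (simp add: f_def filt_def mult.commute)
      also have "\<dots> \<longleftrightarrow> coeff (g M) k \<in> filt (Suc h)"
      proof -
        have d: "coeff (g M') k - coeff (g M) k \<in> filt (Suc h)" using dif by (simp add: polys_def)
        show ?thesis
          using filt_add[OF d, of "coeff (g M) k"] filt_diff[OF _ d, of "coeff (g M') k"] by auto
      qed
      finally show ?thesis .
    qed
    have "f \<in> polys 0" using gh by (simp add: f_def polys_def filt_def)
    then obtain a where a: "a \<in> S" "poly f (e a) \<notin> filt D"
      using D[of f] iff N N' by auto
    have "F a = 0" using a(1) S by auto
    then have "poly (g M') (e a) \<in> filt M'"
      using filt_uminus[OF g(3)[of a M']] by simp
    then have "poly (g M') (e a) \<in> filt (D + h)"
      by (rule filt_antimono) (simp add: M'_def)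
    then have "poly (g M') (e a) / \<pi> ^ h \<in> filt D" by (rule filt_divide)
    with a(2) show False by (simp add: f_def)
  qed
  then have "F a \<in> filt M" for M
    using filt_add[OF g(3)[of a M] poly_mem_filt[OF gM[of M] e(2)[of a]]] by simp
  then show ?thesis using separated by (simp add: filt_def)
qed

end

section \<open>Orbits of a Drinfeld module are analytic\<close>

lemma finite_field_extension_hom:
  assumes "finite_field_extension \<iota>"
  shows "\<iota> 1 = 1" "\<iota> (x + y) = \<iota> x + \<iota> y" "\<iota> (x * y) = \<iota> x * \<iota> y"
    "\<iota> 0 = 0" "\<iota> (- x) = - \<iota> x" "\<iota> (x - y) = \<iota> x - \<iota> y" "\<iota> (x ^ n) = \<iota> x ^ n"
    "\<iota> (of_nat n) = of_nat n" "\<iota> x = 0 \<longleftrightarrow> x = 0" "\<iota> (x / y) = \<iota> x / \<iota> y"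
proof -
  show one: "\<iota> 1 = 1" and add: "\<iota> (x + y) = \<iota> x + \<iota> y" and mult: "\<iota> (x * y) = \<iota> x * \<iota> y" for x y
    using assms by (auto simp: finite_field_extension_def)
  show zero: "\<iota> 0 = 0" using add[of 0 0] by (simp only: add_0 add_cancel_right_right)
  show um: "\<iota> (- x) = - \<iota> x" for x using add[of x "- x"] zero by (simp add: eq_neg_iff_add_eq_0 add.commute)
  show "\<iota> (x - y) = \<iota> x - \<iota> y" using add[of x "- y"] um by simp
  show "\<iota> (x ^ n) = \<iota> x ^ n" by (induction n) (simp_all add: one mult)
  show "\<iota> (of_nat n) = of_nat n" by (induction n) (simp_all add: one add zero)
  have nz: "\<iota> y \<noteq> 0" if "y \<noteq> 0" for y
    using mult[of y "inverse y"] that one by auto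
  then show "\<iota> x = 0 \<longleftrightarrow> x = 0" using zero by auto
  show "\<iota> (x / y) = \<iota> x / \<iota> y"
  proof (cases "y = 0")
    case False
    then have "\<iota> (x / y) * \<iota> y = \<iota> x" by (simp add: mult[symmetric])
    then show ?thesis using nz[OF False] by (simp add: field_simps)
  qed (simp add: zero)
qed

lemma drinfeld_moduleD:
  fixes \<phi> :: "'f::{finite,field} poly \<Rightarrow> 'k::field poly"
  assumes "drinfeld_module \<iota> \<phi>"
  shows "\<phi> a \<in> twisted_polys CARD('f)" "\<phi> (a + b) = \<phi> a + \<phi> b"
    "\<phi> (a * b) = pcompose (\<phi> a) (\<phi> b)" "coeff (\<phi> a) 1 = \<iota> (to_fract a)"
  using assms by (simp_all add: drinfeld_module_def)

text \<open>
  Compare the coefficients of \<open>\<tau>\<^sup>j\<close> on both sides of \<open>\<phi>\<^sub>a \<phi>\<^sub>b = \<phi>\<^sub>b \<phi>\<^sub>a\<close>; since the coefficient of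
  \<open>\<tau>\<^sup>0\<close> in \<open>\<phi>\<^sub>b\<close> is \<open>b\<close>, the terms containing \<open>C\<^sub>j(a)\<close> combine to the left-hand side.
\<close>

lemma drinfeld_coeff_recursion:
  fixes \<phi> :: "'f::{finite,field} poly \<Rightarrow> 'k::field poly"
  assumes \<iota>: "finite_field_extension \<iota>" and \<phi>: "drinfeld_module \<iota> \<phi>"
  defines "q \<equiv> CARD('f)"
  defines "C \<equiv> \<lambda>a j. coeff (\<phi> a) (q ^ j)"
  shows "\<iota> (to_fract (b ^ q ^ j - b)) * C a j =
    (\<Sum>k<j. C b (j - k) * C a k ^ q ^ (j - k) - C a k * C b (j - k) ^ q ^ k)"
proof -
  note hom = finite_field_extension_hom[OF \<iota>]
  note D = drinfeld_moduleD[OF \<phi>]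
  have char: "of_nat k = (0 :: 'k)" if "of_nat k = (0 :: 'f)" for k
  proof -
    have "of_nat k = (0 :: 'f poly)" using that by (simp add: of_nat_poly)
    moreover have "to_fract (of_nat k :: 'f poly) = of_nat k" by (induction k) simp_all
    ultimately have "of_nat k = (0 :: 'f poly fract)" by simp
    then show ?thesis using hom(4,8) by metis
  qed
  have C0: "C b 0 = \<iota> (to_fract b)" using D(4) by (simp add: C_def)
  have pow: "to_fract (b ^ n) = to_fract b ^ n" for n by (induction n) simp_all
  have "(\<Sum>k\<le>j. C a k * C b (j - k) ^ q ^ k) = (\<Sum>k\<le>j. C b k * C a (j - k) ^ q ^ k)"
    using coeff_twisted_pcompose[OF char D(1) D(1), of a b j]
      coeff_twisted_pcompose[OF char D(1) D(1), of b a j] D(3)[of a b] D(3)[of b a]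
    by (simp add: C_def q_def mult.commute)
  also have "\<dots> = (\<Sum>k\<le>j. C b (j - k) * C a k ^ q ^ (j - k))"
    by (rule sum.reindex_bij_witness[of _ "\<lambda>k. j - k" "\<lambda>k. j - k"]) auto
  finally have "(\<Sum>k<j. C a k * C b (j - k) ^ q ^ k) + C a j * C b 0 ^ q ^ j =
      (\<Sum>k<j. C b (j - k) * C a k ^ q ^ (j - k)) + C b 0 * C a j"
    by (simp add: lessThan_Suc_atMost[symmetric])
  then show ?thesis
    by (simp add: sum_subtractf C0 hom pow algebra_simps)
qed

context adic_ring
begin

lemma polys_clear_power:
  assumes "smult (\<pi> ^ w) f \<in> polys 0" "n * w \<le> v"
  shows "smult (\<pi> ^ v) (f ^ n) \<in> polys 0"
proof -
  have "smult (\<pi> ^ v) (f ^ n) = smult (\<pi> ^ (v - n * w)) (smult (\<pi> ^ w) f ^ n)"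
  proof -
    have "\<pi> ^ v = \<pi> ^ (v - n * w) * (\<pi> ^ w) ^ n"
      using assms(2) by (simp add: power_mult[symmetric] power_add[symmetric] mult.commute)
    then show ?thesis by (simp add: smult_power)
  qed
  also have "\<dots> \<in> polys 0"
    using polys_power[OF assms(1), of n] by (simp add: polys_smult_mem power_mem unif_mem)
  finally show ?thesis .
qed

text \<open>
  Solve the recursion with \<open>b = t\<close> for \<open>C\<^sub>j(a)\<close>. By assumption, dividing by \<open>t^(q^j) - t\<close> costs one factor \<open>\<pi>\<close>,
  and raising \<open>C\<^sub>k\<close> to the power \<open>q^(j-k)\<close> multiplies its exponent. The exponents \<open>q^j - 1\<close>
  dominate the resulting recursion because \<open>q^(j-k) * (q^k - 1) + 1 \<le> q^j - 1\<close> for \<open>k < j\<close>.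
\<close>

lemma drinfeld_coeff_polynomial:
  fixes \<phi> :: "'f::{finite,field} poly \<Rightarrow> 'k poly"
  assumes \<iota>: "finite_field_extension \<iota>" and \<phi>: "drinfeld_module \<iota> \<phi>"
    and cR: "\<And>k. coeff (\<phi> [:0, 1:]) k \<in> R"
    and unram: "\<And>j. j > 0 \<Longrightarrow> \<pi> / \<iota> (to_fract ([:0, 1:] ^ CARD('f) ^ j - [:0, 1:])) \<in> R"
  shows "\<exists>D. smult (\<pi> ^ (CARD('f) ^ j - 1)) D \<in> polys 0 \<and>
           (\<forall>a. poly D (\<iota> (to_fract a)) = coeff (\<phi> a) (CARD('f) ^ j))"
proof (induction j rule: less_induct)
  case (less j)
  define q where "q = CARD('f)"
  define C where "C a j = coeff (\<phi> a) (q ^ j)" for a j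
  define e where "e a = \<iota> (to_fract a)" for a
  have q2: "q \<ge> 2" unfolding q_def by (rule CARD_field_ge_2)
  define t where "t = ([:0, 1:] :: 'f poly)"
  show ?case unfolding q_def[symmetric] C_def[symmetric] e_def[symmetric]
  proof (cases "j = 0")
    case True
    then show "\<exists>D. smult (\<pi> ^ (q ^ j - 1)) D \<in> polys 0 \<and> (\<forall>a. poly D (e a) = C a j)"
      using drinfeld_moduleD(4)[OF \<phi>]
      by (intro exI[of _ "[:0, 1:]"])
        (auto simp: polys_def coeff_pCons C_def e_def zero_mem one_mem split: nat.split)
  next
    case False
    define \<Theta> where "\<Theta> = e (t ^ q ^ j - t)"
    have "\<forall>k. \<exists>D. k < j \<longrightarrow> smult (\<pi> ^ (q ^ k - 1)) D \<in> polys 0 \<and> (\<forall>a. poly D (e a) = C a k)"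
      using less.IH unfolding q_def[symmetric] C_def[symmetric] e_def[symmetric] by blast
    then obtain D where D: "\<And>k. k < j \<Longrightarrow> smult (\<pi> ^ (q ^ k - 1)) (D k) \<in> polys 0"
        "\<And>k a. k < j \<Longrightarrow> poly (D k) (e a) = C a k"
      by metis
    have tq: "t ^ q ^ j - t \<noteq> 0"
    proof
      assume "t ^ q ^ j - t = 0"
      then have "degree (t ^ q ^ j) = degree t" by simp
      then have "q ^ j = 1" by (simp add: t_def degree_power_eq)
      then show False using q2 False by simp
    qed
    have \<Theta>0: "\<Theta> \<noteq> 0"
      using tq finite_field_extension_hom(9)[OF \<iota>] by (simp add: \<Theta>_def e_def)
    define A where "A k = smult (C t (j - k)) (D k ^ q ^ (j - k)) - smult (C t (j - k) ^ q ^ k) (D k)" for k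
    have ct: "C t k \<in> R" for k using cR by (simp add: C_def t_def)
    have A: "smult (\<pi> ^ (q ^ j - 2)) (A k) \<in> polys 0" if k: "k < j" for k
    proof -
      have qjk: "q ^ (j - k) \<ge> 2"
        using q2 k power_increasing[of 1 "j - k" q] by (simp add: Suc_le_eq)
      have "q ^ (j - k) * (q ^ k - 1) = q ^ j - q ^ (j - k)"
        using k by (simp add: diff_mult_distrib2 power_add[symmetric])
      then have 1: "q ^ (j - k) * (q ^ k - 1) \<le> q ^ j - 2" using qjk by simp
      have "q ^ k < q ^ j" using k q2 by (intro power_strict_increasing) auto
      then have 2: "1 * (q ^ k - 1) \<le> q ^ j - 2" by simp
      have "smult (\<pi> ^ (q ^ j - 2)) (A k) =
          smult (C t (j - k)) (smult (\<pi> ^ (q ^ j - 2)) (D k ^ q ^ (j - k)))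
          - smult (C t (j - k) ^ q ^ k) (smult (\<pi> ^ (q ^ j - 2)) (D k ^ 1))"
        by (simp add: A_def smult_diff_right mult.commute)
      also have "\<dots> \<in> polys 0"
        by (intro polys_diff polys_smult_mem polys_clear_power[OF D(1)[OF k] 1]
            polys_clear_power[OF D(1)[OF k] 2] ct power_mem)
      finally show ?thesis .
    qed
    have "q ^ j \<ge> 2" using q2 False power_increasing[of 1 j q] by simp
    then have "q ^ j - 1 = Suc (q ^ j - 2)" by simp
    moreover have smult_sum_right: "(\<Sum>k<j. smult c (A k)) = smult c (\<Sum>k<j. A k)" for c
      by (rule poly_eqI) (simp add: coeff_sum sum_distrib_left)
    moreover have "\<pi> ^ Suc n * (1 / \<Theta>) = \<pi> / \<Theta> * \<pi> ^ n" for n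
      by simp
    ultimately have "smult (\<pi> ^ (q ^ j - 1)) (smult (1 / \<Theta>) (\<Sum>k<j. A k)) =
        smult (\<pi> / \<Theta>) (\<Sum>k<j. smult (\<pi> ^ (q ^ j - 2)) (A k))"
      by (simp only: smult_smult smult_sum_right)
    also have "\<dots> \<in> polys 0"
      using polys_smult[of "\<pi> / \<Theta>" 0 _ 0] unram[of j] False polys_sum[of "{..<j}"] A
      by (simp add: \<Theta>_def e_def q_def t_def)
    finally have "smult (\<pi> ^ (q ^ j - 1)) (smult (1 / \<Theta>) (\<Sum>k<j. A k)) \<in> polys 0" .
    moreover have "poly (smult (1 / \<Theta>) (\<Sum>k<j. A k)) (e a) = C a j" for a
    proof -
      have "\<Theta> * C a j = (\<Sum>k<j. C t (j - k) * C a k ^ q ^ (j - k) - C a k * C t (j - k) ^ q ^ k)"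
        unfolding \<Theta>_def e_def C_def q_def by (rule drinfeld_coeff_recursion[OF \<iota> \<phi>])
      also have "\<dots> = poly (\<Sum>k<j. A k) (e a)"
        by (simp add: poly_sum A_def D(2) mult.commute)
      finally show ?thesis using \<Theta>0 by (simp add: field_simps)
    qed
    ultimately show "\<exists>D. smult (\<pi> ^ (q ^ j - 1)) D \<in> polys 0 \<and> (\<forall>a. poly D (e a) = C a j)"
      by blast
  qed
qed

text \<open>
  Divisibility of \<open>y\<close> by \<open>\<pi>\<^sup>2\<close> makes \<open>y^(q^j)\<close> divisible by \<open>\<pi>^(2 * q^j)\<close>, which outweighs the denominator
  \<open>\<pi>^(q^j - 1)\<close> of \<open>C\<^sub>j\<close>. The \<open>j\<close>-th term of \<open>\<phi>\<^sub>a(y) = \<Sum>\<^sub>j C\<^sub>j(a) y^(q^j)\<close>, as a polynomial in \<open>a\<close>, is thus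
  divisible by \<open>\<pi>^j\<close>, and the partial sums are the required approximations. The sum is finite for each \<open>a\<close>,
  but its length is not bounded.
\<close>

theorem drinfeld_orbit_analytic:
  fixes \<phi> :: "'f::{finite,field} poly \<Rightarrow> 'k poly"
  assumes \<iota>: "finite_field_extension \<iota>" and \<phi>: "drinfeld_module \<iota> \<phi>"
    and cR: "\<And>k. coeff (\<phi> [:0, 1:]) k \<in> R"
    and unram: "\<And>j. j > 0 \<Longrightarrow> \<pi> / \<iota> (to_fract ([:0, 1:] ^ CARD('f) ^ j - [:0, 1:])) \<in> R"
    and eR: "\<And>a. \<iota> (to_fract a) \<in> R"
    and y: "y \<in> filt 2"
  shows "analytic (\<lambda>a. \<iota> (to_fract a)) (\<lambda>a. poly (\<phi> a) y)"
proof -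
  define q where "q = CARD('f)"
  have q2: "q \<ge> 2" unfolding q_def by (rule CARD_field_ge_2)
  obtain D where D: "\<And>j. smult (\<pi> ^ (q ^ j - 1)) (D j) \<in> polys 0"
      "\<And>j a. poly (D j) (\<iota> (to_fract a)) = coeff (\<phi> a) (q ^ j)"
    using drinfeld_coeff_polynomial[OF \<iota> \<phi> cR unram] unfolding q_def by metis
  define T where "T j = smult (y ^ q ^ j) (D j)" for j
  have T: "T j \<in> polys j" for j
  proof -
    have qj: "j < q ^ j" using q2 by (simp add: power_gt_expt)
    have "y ^ q ^ j \<in> filt (q ^ j + 1 + (q ^ j - 1))"
      by (rule filt_antimono[OF filt_power[OF y, of "q ^ j"]]) (use qj in linarith)
    then have "y ^ q ^ j / \<pi> ^ (q ^ j - 1) \<in> filt (q ^ j + 1)" by (rule filt_divide)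
    then have "y ^ q ^ j / \<pi> ^ (q ^ j - 1) \<in> filt j" by (rule filt_antimono) (use qj in simp)
    from polys_smult[OF this D(1)[of j]] show ?thesis by (simp add: T_def unif_nonzero)
  qed
  show ?thesis unfolding analytic_def
  proof (intro exI[of _ "\<lambda>M. \<Sum>j<M. T j"] conjI allI)
    show "(\<Sum>j<M. T j) \<in> polys 0" for M
      by (intro polys_sum polys_antimono[OF T]) simp
    show "(\<Sum>j<Suc M. T j) - (\<Sum>j<M. T j) \<in> polys M" for M
      using T by simp
    fix a M
    obtain n where n: "\<And>m. m \<ge> n \<Longrightarrow> \<phi> a = (\<Sum>k\<le>m. monom (coeff (\<phi> a) (q ^ k)) (q ^ k))"
      using twisted_polys_eq_sum[OF drinfeld_moduleD(1)[OF \<phi>] q2[unfolded q_def]]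
      unfolding q_def by blast
    define m where "m = n + M"
    have "poly (\<phi> a) y = (\<Sum>j\<le>m. poly (T j) (\<iota> (to_fract a)))"
      by (subst n[of m]) (simp_all add: m_def poly_sum poly_monom T_def D(2) mult.commute)
    also have "{..m} = {..<M} \<union> {M..m}" by (auto simp: m_def)
    also have "(\<Sum>j\<in>{..<M} \<union> {M..m}. poly (T j) (\<iota> (to_fract a))) =
        (\<Sum>j<M. poly (T j) (\<iota> (to_fract a))) + (\<Sum>j=M..m. poly (T j) (\<iota> (to_fract a)))"
      by (rule sum.union_disjoint) auto
    finally have "poly (\<phi> a) y - poly (\<Sum>j<M. T j) (\<iota> (to_fract a)) =
        (\<Sum>j=M..m. poly (T j) (\<iota> (to_fract a)))"
      by (simp add: poly_sum)
    also have "\<dots> \<in> filt M"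
      by (intro filt_sum poly_mem_filt polys_antimono[OF T] eR) simp
    finally show "poly (\<phi> a) y - poly (\<Sum>j<M. T j) (\<iota> (to_fract a)) \<in> filt M" .
  qed
qed

end

section \<open>The local ring at a prime of \<open>F\<^sub>q[t]\<close>\<close>

definition local_fracts :: "'f::field poly \<Rightarrow> 'f poly fract set" where
  "local_fracts P = {to_fract n / to_fract d | n d. \<not> P dvd d}"

lemma local_fractsE:
  assumes "z \<in> local_fracts P"
  obtains n d where "\<not> P dvd d" "z = to_fract n / to_fract d"
  using assms by (auto simp: local_fracts_def)

lemma to_fract_in_local_fracts: "\<not> is_unit P \<Longrightarrow> to_fract n \<in> local_fracts P"
  unfolding local_fracts_def by (intro CollectI exI[of _ n] exI[of _ 1]) simp

lemma local_fracts_closed: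
  assumes P: "prime_elem P" and z: "z \<in> local_fracts P" and w: "w \<in> local_fracts P"
  shows "z + w \<in> local_fracts P" "z * w \<in> local_fracts P"
proof -
  obtain n d where z: "\<not> P dvd d" "z = to_fract n / to_fract d" using z by (rule local_fractsE)
  obtain m e where w: "\<not> P dvd e" "w = to_fract m / to_fract e" using w by (rule local_fractsE)
  have de: "\<not> P dvd d * e" using z(1) w(1) P by (simp add: prime_elem_dvd_mult_iff)
  have "d \<noteq> 0" "e \<noteq> 0" using z(1) w(1) by auto
  then have "z + w = to_fract (n * e + m * d) / to_fract (d * e)"
    by (simp add: z(2) w(2) add_frac_eq)
  then show "z + w \<in> local_fracts P" using de unfolding local_fracts_def by blast
  have "z * w = to_fract (n * m) / to_fract (d * e)" by (simp add: z(2) w(2))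
  then show "z * w \<in> local_fracts P" using de unfolding local_fracts_def by blast
qed

lemma local_fracts_uminus:
  assumes "z \<in> local_fracts P"
  shows "- z \<in> local_fracts P"
proof -
  obtain n d where "\<not> P dvd d" "z = to_fract n / to_fract d" using assms by (rule local_fractsE)
  then have "\<not> P dvd d" "- z = to_fract (- n) / to_fract d" by simp_all
  then show ?thesis unfolding local_fracts_def by blast
qed

lemma prime_power_dvd_mult_cancel:
  fixes P :: "'r::idom"
  assumes "prime_elem P" "\<not> P dvd d" "P ^ M dvd n * d"
  shows "P ^ M dvd n"
  using assms(3)
proof (induction M arbitrary: n)
  case (Suc M)
  have "P dvd n * d" using Suc.prems by (metis dvd_mult_left power_Suc)
  then obtain n' where n: "n = P * n'"
    using assms(1,2) by (auto simp: prime_elem_dvd_mult_iff)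
  have "P \<noteq> 0" using assms(1) by auto
  then have "P ^ M dvd n' * d" using Suc.prems by (simp add: n mult.assoc)
  then have "P ^ M dvd n'" by (rule Suc.IH)
  then show ?case by (simp add: n)
qed simp

lemma prime_elem_degree_pos:
  fixes P :: "'f::field poly"
  shows "prime_elem P \<Longrightarrow> degree P > 0"
  using is_unit_iff_degree[of P] by (auto simp: prime_elem_def)

lemma local_fracts_separated:
  assumes P: "prime_elem P" and z: "\<And>M. z / to_fract P ^ M \<in> local_fracts P"
  shows "z = 0"
proof -
  obtain a b where b: "\<not> P dvd b" and zab: "z = to_fract a / to_fract b"
    using z[of 0, simplified] by (rule local_fractsE)
  have nz: "b \<noteq> 0" "P \<noteq> 0" using b P by auto
  have "P ^ M dvd a" for M
  proof -
    have pow: "to_fract (P ^ M) = to_fract P ^ M" by (induction M) simp_all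
    obtain n d where d: "\<not> P dvd d" "z / to_fract P ^ M = to_fract n / to_fract d"
      using z by (rule local_fractsE)
    have "d \<noteq> 0" using d by auto
    then have "to_fract (a * d) = to_fract (P ^ M * (n * b))"
      using d(2) nz by (simp add: zab pow field_simps)
    then have "a * d = P ^ M * (n * b)" by (simp only: to_fract_eq_iff)
    then have "P ^ M dvd a * d" by simp
    then show ?thesis by (rule prime_power_dvd_mult_cancel[OF P d(1)])
  qed
  then have *: "P ^ Suc (degree a) dvd a" .
  have "a = 0"
  proof (rule ccontr)
    assume "a \<noteq> 0"
    then have "degree (P ^ Suc (degree a)) \<le> degree a" using * by (rule dvd_imp_degree_le[rotated])
    moreover have "Suc (degree a) * 1 \<le> Suc (degree a) * degree P"
      using prime_elem_degree_pos[OF P] by (intro mult_le_mono2) simp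
    ultimately show False using nz by (simp add: degree_power_eq degree_mult_eq)
  qed
  then show ?thesis by (simp add: zab)
qed

lemma prime_elem_remove_powers:
  fixes P b :: "'f::field poly"
  assumes "prime_elem P" "b \<noteq> 0"
  shows "\<exists>h c. b = P ^ h * c \<and> \<not> P dvd c"
  using assms(2)
proof (induction "degree b" arbitrary: b rule: less_induct)
  case less
  show ?case
  proof (cases "P dvd b")
    case True
    then obtain c where c: "b = P * c" by (auto elim: dvdE)
    have "degree c < degree b" "c \<noteq> 0"
      using less.prems prime_elem_degree_pos[OF assms(1)] by (auto simp: c degree_mult_eq)
    from less.hyps[OF this] obtain h d where "c = P ^ h * d" "\<not> P dvd d" by blast
    then show ?thesis by (intro exI[of _ "Suc h"] exI[of _ d]) (simp add: c mult.assoc)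
  qed (intro exI[of _ 0] exI[of _ b], simp)
qed

lemma local_fracts_absorbing:
  assumes P: "prime_elem P"
  shows "\<exists>h. to_fract P ^ h * z \<in> local_fracts P"
proof -
  obtain a b where z: "z = to_fract a / to_fract b" and b: "b \<noteq> 0"
    by (cases z) (auto simp: Fract_conv_to_fract)
  obtain h c where c: "b = P ^ h * c" "\<not> P dvd c"
    using prime_elem_remove_powers[OF P b] by blast
  have pow: "to_fract (P ^ h) = to_fract P ^ h" by (induction h) simp_all
  have "P \<noteq> 0" using P by auto
  then have "to_fract P ^ h * z = to_fract a / to_fract c" by (simp add: z c pow)
  then show ?thesis using c(2) unfolding local_fracts_def by blast
qed

lemma finite_degree_le: "finite {p :: 'f::{finite,field} poly. degree p \<le> n}"
proof -
  have "{p :: 'f poly. degree p \<le> n} \<subseteq> Poly ` {xs. set xs \<subseteq> UNIV \<and> length xs \<le> Suc n}"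
  proof
    fix p :: "'f poly" assume "p \<in> {p. degree p \<le> n}"
    then have "length (coeffs p) \<le> Suc n"
      by (cases "p = 0") (simp_all add: length_coeffs_degree)
    then show "p \<in> Poly ` {xs. set xs \<subseteq> UNIV \<and> length xs \<le> Suc n}"
      by (intro image_eqI[of _ _ "coeffs p"]) simp_all
  qed
  then show ?thesis by (rule finite_subset) (intro finite_imageI finite_lists_length_le finite)
qed

lemma finite_range_mod:
  fixes b :: "'f::{finite,field} poly"
  assumes "b \<noteq> 0"
  shows "finite (range (\<lambda>a. a mod b))"
proof (rule finite_subset[OF _ finite_degree_le[of "degree b"]])
  have "degree (a mod b) \<le> degree b" for a
    using degree_mod_less[OF assms, of a] by (elim disjE) simp_all
  then show "range (\<lambda>a. a mod b) \<subseteq> {p. degree p \<le> degree b}" by blast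
qed

text \<open>
  The class of \<open>n / d\<close> modulo \<open>P\<^sup>2\<close> is determined by the residues of \<open>n\<close> and \<open>d\<close> in the finite ring
  \<open>A / P\<^sup>2\<close>, because \<open>n / d - n' / d' = (n d' - n' d) / (d d')\<close>.
\<close>

lemma local_fracts_finite_residues:
  fixes P :: "'f::{finite,field} poly"
  assumes P: "prime_elem P"
  shows "\<exists>T. finite T \<and> (\<forall>z\<in>local_fracts P. \<exists>w\<in>T. (z - w) / to_fract P ^ 2 \<in> local_fracts P)"
proof -
  have P0: "P \<noteq> 0" using P by auto
  obtain n d where nd: "\<And>z. z \<in> local_fracts P \<Longrightarrow> \<not> P dvd d z \<and> z = to_fract (n z) / to_fract (d z)"
  proof -
    have "\<forall>z. \<exists>n d. z \<in> local_fracts P \<longrightarrow> \<not> P dvd d \<and> z = to_fract n / to_fract d"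
      by (auto simp: local_fracts_def)
    then show ?thesis using that by metis
  qed
  define cl where "cl z = (n z mod P\<^sup>2, d z mod P\<^sup>2)" for z
  have close: "(z - w) / to_fract P ^ 2 \<in> local_fracts P"
    if z: "z \<in> local_fracts P" and w: "w \<in> local_fracts P" and eq: "cl z = cl w" for z w
  proof -
    have "P\<^sup>2 dvd n z - n w" "P\<^sup>2 dvd d z - d w"
      using eq by (auto simp: cl_def mod_eq_dvd_iff)
    then have "P\<^sup>2 dvd (n z - n w) * d w - n w * (d z - d w)"
      by (intro dvd_diff[OF dvd_mult2 dvd_mult])
    then obtain m where m: "(n z - n w) * d w - n w * (d z - d w) = P\<^sup>2 * m" by (auto elim: dvdE)
    have nz: "d z \<noteq> 0" "d w \<noteq> 0" using nd[OF z] nd[OF w] by auto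
    have "z - w = to_fract (n z) / to_fract (d z) - to_fract (n w) / to_fract (d w)"
      using nd[OF z] nd[OF w] by simp
    also have "\<dots> = to_fract (n z * d w - n w * d z) / to_fract (d z * d w)"
      using nz by (simp add: diff_frac_eq)
    also have "n z * d w - n w * d z = P\<^sup>2 * m" using m by (simp add: algebra_simps)
    finally have "(z - w) / to_fract P ^ 2 = to_fract m / to_fract (d z * d w)"
      using P0 by (simp add: power2_eq_square)
    moreover have "\<not> P dvd d z * d w" using nd[OF z] nd[OF w] P by (simp add: prime_elem_dvd_mult_iff)
    ultimately show ?thesis unfolding local_fracts_def by blast
  qed
  have fin: "finite (cl ` local_fracts P)"
    by (rule finite_subset[of _ "range (\<lambda>a. a mod P\<^sup>2) \<times> range (\<lambda>a. a mod P\<^sup>2)"])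
      (use P0 in \<open>auto simp: cl_def intro!: finite_cartesian_product finite_range_mod\<close>)
  obtain T where T: "T \<subseteq> local_fracts P" "finite T" "cl ` local_fracts P = cl ` T"
    using finite_subset_image[OF fin, of cl "local_fracts P"] by auto
  show ?thesis
  proof (intro exI[of _ T] conjI ballI)
    fix z assume z: "z \<in> local_fracts P"
    then obtain w where "w \<in> T" "cl z = cl w" using T(3) by (metis imageE imageI)
    then show "\<exists>w\<in>T. (z - w) / to_fract P ^ 2 \<in> local_fracts P"
      using close[OF z] T(1) by blast
  qed (rule T)
qed

text \<open>
  Euclid's argument: a nonconstant divisor of \<open>t * d + 1\<close> of least degree is prime and does not divide \<open>d\<close>.
\<close>

lemma exists_prime_elem_not_dvd:
  fixes d :: "'f::field poly"
  assumes "d \<noteq> 0"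
  shows "\<exists>P. prime_elem P \<and> \<not> P dvd d"
proof -
  define g where "g = [:0, 1:] * d + 1"
  have "degree g > 0"
  proof -
    have "degree ([:0, 1:] * d) = Suc (degree d)" using assms by simp
    then show ?thesis unfolding g_def by (subst degree_add_eq_left) simp_all
  qed
  define good where "good P \<longleftrightarrow> P dvd g \<and> degree P > 0" for P
  have "good g" using \<open>degree g > 0\<close> by (simp add: good_def)
  define P where "P = arg_min degree good"
  have "good P" unfolding P_def using \<open>good g\<close> by (rule arg_min_natI)
  then have P: "P dvd g" "degree P > 0" by (simp_all add: good_def)
  have min: "degree P \<le> degree Q" if "Q dvd g" "degree Q > 0" for Q
    unfolding P_def by (rule arg_min_nat_le) (simp add: good_def that)
  have "irreducible P"
  proof (rule irreducibleI)
    show "P \<noteq> 0" using P(2) by auto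
    then show "\<not> is_unit P" using P(2) is_unit_iff_degree[of P] by simp
    fix a b assume ab: "P = a * b"
    have nz: "a \<noteq> 0" "b \<noteq> 0" using \<open>P \<noteq> 0\<close> ab by auto
    then have deg: "degree P = degree a + degree b" by (simp add: ab degree_mult_eq)
    have "a dvd g" using P(1) ab by (auto intro: dvd_mult_left)
    then have "degree a = 0 \<or> degree b = 0" using min[of a] deg by force
    then show "is_unit a \<or> is_unit b" using nz is_unit_iff_degree by blast
  qed
  then have prime: "prime_elem P" by (rule field_poly_irreducible_imp_prime)
  moreover have "\<not> P dvd d"
  proof
    assume "P dvd d"
    then have "P dvd 1" using P(1) by (metis dvd_add_right_iff dvd_mult g_def)
    then show False using prime by (simp add: prime_elem_def)
  qed
  ultimately show ?thesis by blast
qed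

lemma exists_local_fracts_superset:
  fixes E :: "'f::field poly fract set"
  assumes "finite E"
  shows "\<exists>P. prime_elem P \<and> E \<subseteq> local_fracts P"
proof -
  have "\<forall>z :: 'f poly fract. \<exists>n d. d \<noteq> 0 \<and> z = to_fract n / to_fract d"
  proof
    fix z :: "'f poly fract"
    show "\<exists>n d. d \<noteq> 0 \<and> z = to_fract n / to_fract d"
      by (cases z) (auto simp: Fract_conv_to_fract)
  qed
  then obtain n d where nd: "\<And>z :: 'f poly fract. d z \<noteq> 0 \<and> z = to_fract (n z) / to_fract (d z)"
    by metis
  have "(\<Prod>z\<in>E. d z) \<noteq> 0" using nd assms by (simp add: prod_zero_iff)
  then obtain P where P: "prime_elem P" "\<not> P dvd (\<Prod>z\<in>E. d z)"
    using exists_prime_elem_not_dvd by blast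
  have "z \<in> local_fracts P" if "z \<in> E" for z
  proof -
    have "\<not> P dvd d z" using P(2) that assms by (meson dvd_prodI dvd_trans)
    then show ?thesis using nd[of z] unfolding local_fracts_def by blast
  qed
  then show ?thesis using P(1) by blast
qed

text \<open>
  The polynomial \<open>t^(q^j) - t\<close> is squarefree since its derivative is \<open>-1\<close>.
\<close>

lemma prime_square_not_dvd_power_CARD_diff:
  fixes P :: "'f::{finite,field} poly"
  assumes P: "prime_elem P" and "j > 0"
  shows "\<not> P\<^sup>2 dvd [:0, 1:] ^ CARD('f) ^ j - [:0, 1:]"
proof
  assume "P\<^sup>2 dvd [:0, 1:] ^ CARD('f) ^ j - [:0, 1:]"
  then obtain h where h: "[:0, 1:] ^ CARD('f) ^ j - [:0, 1:] = P\<^sup>2 * h" by (auto elim: dvdE)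
  have "of_nat CARD('f) = (0 :: 'f)"
    using of_nat_CARD_choose_eq_0[of 1, where 'f = 'f] CARD_field_ge_2[where 'f = 'f] by simp
  then have "of_nat (CARD('f) ^ j) = (0 :: 'f)" using assms(2) by (simp add: zero_power)
  then have "pderiv ([:0, 1 :: 'f:] ^ CARD('f) ^ j) = 0"
    by (simp add: monom_altdef[of 1, simplified, symmetric] pderiv_monom)
  then have "- 1 = pderiv (P\<^sup>2 * h)"
    by (simp add: h[symmetric] pderiv_diff pderiv_pCons one_pCons)
  also have "\<dots> = P * (2 * pderiv P * h + P * pderiv h)"
    by (simp add: pderiv_mult power2_eq_square algebra_simps)
  finally have "P dvd - 1" by (rule dvdI)
  then show False using P by (simp add: prime_elem_def)
qed

section \<open>An adic ring in \<open>K\<close> containing given elements\<close>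

text \<open>
  A basis and its coordinate functions, freed from the vector space locale.
\<close>

lemma finite_field_extension_coordinates:
  fixes \<iota> :: "'a::field \<Rightarrow> 'b::field"
  assumes "finite_field_extension \<iota>"
  shows "\<exists>(B :: 'b set) co. finite B \<and> (\<forall>x y b. co (x + y) b = co x b + co y b) \<and>
    (\<forall>c x b. co (\<iota> c * x) b = c * co x b) \<and> (\<forall>x. x = (\<Sum>b\<in>B. \<iota> (co x b) * b))"
proof -
  obtain B where "finite_dimensional_vector_space (\<lambda>c x. \<iota> c * x) B"
    using assms by (auto simp: finite_field_extension_def)
  then interpret V: finite_dimensional_vector_space "\<lambda>c x. \<iota> c * x" B .
  note ind = V.independent_Basis
  have sp: "x \<in> V.span B" for x using V.span_Basis by simp
  show ?thesis
  proof (intro exI[of _ B] exI[of _ "V.representation B"] conjI allI)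
    show "x = (\<Sum>b\<in>B. \<iota> (V.representation B x b) * b)" for x
      by (rule V.sum_representation_eq[OF ind sp V.finite_Basis order_refl, symmetric])
  qed (simp_all add: V.finite_Basis V.representation_add[OF ind sp sp] V.representation_scale[OF ind sp])
qed

text \<open>
  The last three conclusions are what the orbits need: \<open>A \<subseteq> R\<close>, at most one factor \<open>\<pi>\<close> in the
  denominators \<open>t^(q^j) - t\<close>, and finiteness of \<open>R / \<pi>\<^sup>2 R\<close>. The set \<open>R\<close> of elements with coordinates in the
  local ring at \<open>P\<close> is closed under multiplication as soon as the products of basis elements belong to it,
  and \<open>P\<close> can be chosen so since only finitely many denominators occur.
\<close>

lemma exists_adic_ring:
  fixes \<iota> :: "'f::{finite,field} poly fract \<Rightarrow> 'k::field"
  assumes \<iota>: "finite_field_extension \<iota>" and E: "finite E"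
  shows "\<exists>R \<pi>. adic_ring R \<pi> \<and> E \<subseteq> R \<and> (\<forall>a. \<iota> (to_fract a) \<in> R) \<and>
    (\<forall>j>0. \<pi> / \<iota> (to_fract ([:0, 1:] ^ CARD('f) ^ j - [:0, 1:])) \<in> R) \<and>
    (\<exists>T. finite T \<and> (\<forall>z\<in>R. \<exists>w\<in>T. (z - w) / \<pi> ^ 2 \<in> R))"
proof -
  note hom = finite_field_extension_hom[OF \<iota>]
  have \<iota>_sum: "\<iota> (\<Sum>i\<in>I. f i) = (\<Sum>i\<in>I. \<iota> (f i))" for f :: "'k \<Rightarrow> _" and I
    by (induction I rule: infinite_finite_induct) (simp_all add: hom)
  obtain B :: "'k set" and co where Bco: "finite B \<and> (\<forall>x y b. co (x + y) b = co x b + co y b) \<and>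
      (\<forall>c x b. co (\<iota> c * x) b = c * co x b) \<and> (\<forall>x. x = (\<Sum>b\<in>B. \<iota> (co x b) * b))"
    using finite_field_extension_coordinates[OF \<iota>] by (elim exE) (rule that)
  then have B: "finite B" and co_add: "co (x + y) b = co x b + co y b"
    and co_scale: "co (\<iota> c * x) b = c * co x b" for x y b c
    by simp_all
  have co: "x = (\<Sum>b\<in>B. \<iota> (co x b) * b)" for x
    using Bco by (elim conjE) (rule spec)
  have co_0: "co 0 b = 0" for b using co_scale[of 0 0 b] by (simp add: hom)
  have co_sum: "co (\<Sum>i\<in>I. f i) b = (\<Sum>i\<in>I. co (f i) b)" for f :: "'k \<Rightarrow> _" and I b
    by (induction I rule: infinite_finite_induct) (simp_all add: co_0 co_add)
  have co_mult: "co (x * y) c = (\<Sum>b\<in>B. \<Sum>b'\<in>B. co x b * (co y b' * co (b * b') c))" for x y c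
  proof -
    have "x * y = (\<Sum>b\<in>B. \<Sum>b'\<in>B. \<iota> (co x b) * (\<iota> (co y b') * (b * b')))"
    proof -
      have "x * y = (\<Sum>b\<in>B. \<iota> (co x b) * b) * (\<Sum>b'\<in>B. \<iota> (co y b') * b')"
        by (rule arg_cong2[where f = "(*)"]) (rule co)+
      then show ?thesis by (simp add: sum_product mult_ac)
    qed
    then show ?thesis by (simp add: co_sum co_scale)
  qed
  define G where "G = insert 1 (E \<union> B \<union> (\<lambda>(b, b'). b * b') ` (B \<times> B))"
  have "finite ((\<lambda>(x, b). co x b) ` (G \<times> B))" using E B by (simp add: G_def)
  then obtain P where P: "prime_elem P" and XP: "(\<lambda>(x, b). co x b) ` (G \<times> B) \<subseteq> local_fracts P"
    using exists_local_fracts_superset by blast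
  define L where "L = local_fracts P"
  have P0: "P \<noteq> 0" and Pu: "\<not> is_unit P" using P by auto
  have L_int: "to_fract n \<in> L" for n unfolding L_def by (rule to_fract_in_local_fracts[OF Pu])
  have L_0: "0 \<in> L" and L_1: "1 \<in> L" using L_int[of 0] L_int[of 1] by simp_all
  have L_add: "z + w \<in> L" and L_mult: "z * w \<in> L" if "z \<in> L" "w \<in> L" for z w
    using local_fracts_closed[OF P] that by (simp_all add: L_def)
  have L_minus: "- z \<in> L" if "z \<in> L" for z
    using local_fracts_uminus[OF that[unfolded L_def]] by (simp add: L_def)
  have L_sum: "(\<Sum>i\<in>I. f i) \<in> L" if "\<And>i. i \<in> I \<Longrightarrow> f i \<in> L" for f :: "'k \<Rightarrow> _" and I
    using that by (induction I rule: infinite_finite_induct) (simp_all add: L_0 L_add)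
  define R where "R = {z. \<forall>b\<in>B. co z b \<in> L}"
  define \<pi> where "\<pi> = \<iota> (to_fract P)"
  have \<pi>0: "\<pi> \<noteq> 0" using P0 by (simp add: \<pi>_def hom)
  have XR: "G \<subseteq> R" using XP by (auto simp: R_def L_def)
  have R_mult: "x * y \<in> R" if "x \<in> R" "y \<in> R" for x y
  proof -
    have "co (b * b') c \<in> L" if "b \<in> B" "b' \<in> B" "c \<in> B" for b b' c
      using XR that by (auto simp: G_def R_def)
    then have "co (x * y) c \<in> L" if "c \<in> B" for c
      using \<open>x \<in> R\<close> \<open>y \<in> R\<close> that
      by (subst co_mult) (auto simp: R_def intro!: L_sum L_mult)
    then show ?thesis by (simp add: R_def)
  qed
  have R_1: "1 \<in> R" using XR by (simp add: G_def)
  have R_L: "\<iota> c \<in> R" if "c \<in> L" for c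
    using R_1 that co_scale[of c 1] by (simp add: R_def L_mult)
  have R_sum: "(\<Sum>i\<in>I. f i) \<in> R" if "\<And>i. i \<in> I \<Longrightarrow> f i \<in> R" for f :: "'k \<Rightarrow> _" and I
    using that by (simp add: R_def co_sum L_sum)
  have div: "z / \<pi> ^ M = \<iota> (1 / to_fract P ^ M) * z" for z M
    by (simp add: \<pi>_def hom)
  have "adic_ring R \<pi>"
  proof
    show "0 \<in> R" by (simp add: R_def co_0 L_0)
    show "1 \<in> R" by (rule R_1)
    show "x + y \<in> R" if "x \<in> R" "y \<in> R" for x y using that by (simp add: R_def co_add L_add)
    show "x * y \<in> R" if "x \<in> R" "y \<in> R" for x y using that by (rule R_mult)
    show "- x \<in> R" if "x \<in> R" for x
      using R_mult[OF R_L[OF L_minus[OF L_1]] that] by (simp add: hom)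
    show "\<pi> \<in> R" unfolding \<pi>_def by (rule R_L[OF L_int])
    show "\<pi> \<noteq> 0" by (rule \<pi>0)
    show "z = 0" if "\<And>M. z / \<pi> ^ M \<in> R" for z
    proof -
      have "co z b = 0" if b: "b \<in> B" for b
      proof (rule local_fracts_separated[OF P])
        fix M
        have "co (z / \<pi> ^ M) b \<in> L" using \<open>\<And>M. z / \<pi> ^ M \<in> R\<close> b by (simp add: R_def)
        then show "co z b / to_fract P ^ M \<in> local_fracts P" by (simp add: div co_scale L_def)
      qed
      then have "(\<Sum>b\<in>B. \<iota> (co z b) * b) = 0" by (simp add: hom)
      then show "z = 0" using co[of z] by (rule trans[rotated])
    qed
    show "\<exists>h. \<pi> ^ h * z \<in> R" for z
    proof -
      have "\<forall>b. \<exists>h. to_fract P ^ h * co z b \<in> L"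
        using local_fracts_absorbing[OF P] by (simp add: L_def)
      then obtain h where h: "\<And>b. to_fract P ^ h b * co z b \<in> L" by metis
      define H where "H = (\<Sum>b\<in>B. h b)"
      have *: "to_fract P ^ H * co z b \<in> L" if b: "b \<in> B" for b
      proof -
        have "h b \<le> H" unfolding H_def using b B by (simp add: member_le_sum)
        then have eq: "to_fract P ^ H * co z b = to_fract P ^ (H - h b) * (to_fract P ^ h b * co z b)"
          by (simp add: power_add[symmetric] mult.assoc[symmetric])
        have "to_fract P ^ n \<in> L" for n by (induction n) (simp_all add: L_1 L_mult L_int)
        then show ?thesis unfolding eq by (rule L_mult[OF _ h])
      qed
      have "\<pi> ^ H * z = \<iota> (to_fract P ^ H) * z" by (simp add: \<pi>_def hom)
      then have "co (\<pi> ^ H * z) b = to_fract P ^ H * co z b" for b by (simp only: co_scale)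
      then have "\<pi> ^ H * z \<in> R" using * by (simp only: R_def mem_Collect_eq) blast
      then show ?thesis ..
    qed
  qed
  moreover have "E \<subseteq> R" using XR by (simp add: G_def)
  moreover have "\<iota> (to_fract a) \<in> R" for a by (rule R_L[OF L_int])
  moreover have "\<pi> / \<iota> (to_fract ([:0, 1:] ^ CARD('f) ^ j - [:0, 1:])) \<in> R" if "j > 0" for j
  proof -
    define u :: "'f poly" where "u = [:0, 1:] ^ CARD('f) ^ j - [:0, 1:]"
    have u: "\<not> P\<^sup>2 dvd u" unfolding u_def by (rule prime_square_not_dvd_power_CARD_diff[OF P that])
    have "to_fract P / to_fract u \<in> L"
    proof (cases "P dvd u")
      case False
      then show ?thesis unfolding L_def local_fracts_def by blast
    next
      case True
      then obtain v where v: "u = P * v" by (auto elim: dvdE)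
      have "\<not> P dvd v" using u by (auto simp: v power2_eq_square)
      moreover have "to_fract P / to_fract u = to_fract 1 / to_fract v"
        using P0 by (simp add: v)
      ultimately show ?thesis unfolding L_def local_fracts_def by blast
    qed
    from R_L[OF this] show ?thesis by (simp add: \<pi>_def hom u_def[symmetric])
  qed
  moreover have "\<exists>T. finite T \<and> (\<forall>z\<in>R. \<exists>w\<in>T. (z - w) / \<pi> ^ 2 \<in> R)"
  proof -
    obtain T where T: "finite T" "\<And>z. z \<in> L \<Longrightarrow> \<exists>w\<in>T. (z - w) / to_fract P ^ 2 \<in> L"
      using local_fracts_finite_residues[OF P] unfolding L_def by blast
    define T' where "T' = (\<lambda>f. \<Sum>b\<in>B. \<iota> (f b) * b) ` (B \<rightarrow>\<^sub>E T)"
    have "finite T'" unfolding T'_def using B T(1) by (intro finite_imageI finite_PiE) auto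
    moreover have "\<exists>w\<in>T'. (z - w) / \<pi> ^ 2 \<in> R" if z: "z \<in> R" for z
    proof -
      have "\<forall>b\<in>B. \<exists>w\<in>T. (co z b - w) / to_fract P ^ 2 \<in> L" using z T(2) by (simp add: R_def)
      then obtain f where f: "\<And>b. b \<in> B \<Longrightarrow> f b \<in> T \<and> (co z b - f b) / to_fract P ^ 2 \<in> L" by metis
      define w where "w = (\<Sum>b\<in>B. \<iota> (f b) * b)"
      have "w = (\<Sum>b\<in>B. \<iota> (restrict f B b) * b)" unfolding w_def by (rule sum.cong) auto
      then have "w \<in> T'" unfolding T'_def using f by (intro image_eqI[of _ _ "restrict f B"]) auto
      have "z - w = (\<Sum>b\<in>B. \<iota> (co z b - f b) * b)"
      proof -
        have "z - w = (\<Sum>b\<in>B. \<iota> (co z b) * b) - w"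
          by (rule arg_cong2[where f = "(-)"]) (rule co, rule refl)
        then show ?thesis by (simp add: w_def hom left_diff_distrib sum_subtractf)
      qed
      then have "(z - w) / \<pi> ^ 2 = (\<Sum>b\<in>B. \<iota> ((co z b - f b) / to_fract P ^ 2) * b)"
        by (simp add: sum_divide_distrib hom \<pi>_def)
      also have "\<dots> \<in> R"
        using f XR by (intro R_sum R_mult R_L) (auto simp: G_def)
      finally show ?thesis using \<open>w \<in> T'\<close> by blast
    qed
    ultimately show ?thesis by blast
  qed
  ultimately show ?thesis by blast
qed

section \<open>Intersection of a cyclic submodule with a subvariety\<close>

lemma poly_map_poly_to_ac: "poly (map_poly to_ac p) (to_ac z) = to_ac (poly p z)"
  by (induction p) (simp_all add: map_poly_pCons)

definition to_ac_vec :: "('n::finite \<Rightarrow> 'k::field) \<Rightarrow> 'k alg_closure ^ 'n" where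
  "to_ac_vec z = (\<chi> i. to_ac (z i))"

lemma rational_points_eq: "rational_points = range to_ac_vec"
proof (rule subset_antisym; rule subsetI)
  fix z :: "'k::field alg_closure ^ 'n::finite" assume "z \<in> rational_points"
  then have "\<forall>i. \<exists>w. z $ i = to_ac w" by (auto simp: rational_points_def)
  then obtain w where "\<And>i. z $ i = to_ac (w i)" by metis
  then have "z = to_ac_vec w" by (simp add: to_ac_vec_def vec_eq_iff)
  then show "z \<in> range to_ac_vec" by simp
qed (auto simp: rational_points_def to_ac_vec_def)

lemma act_to_ac_vec: "act \<phi> a (to_ac_vec z) = to_ac_vec (\<lambda>i. poly (\<phi> i a) (z i))"
  by (simp add: act_def to_ac_vec_def vec_eq_iff poly_map_poly_to_ac)

lemma to_ac_vec_add: "to_ac_vec z + to_ac_vec w = to_ac_vec (\<lambda>i. z i + w i)"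
  and to_ac_vec_uminus: "- to_ac_vec z = to_ac_vec (\<lambda>i. - z i)"
  and to_ac_vec_zero: "0 = to_ac_vec (\<lambda>i. 0)"
  by (simp_all add: to_ac_vec_def vec_eq_iff)

lemma eval_mpoly_to_ac_vec:
  "eval_mpoly f (to_ac_vec z) = to_ac (\<Sum>m\<in>Poly_Mapping.keys f.
     Poly_Mapping.lookup f m * (\<Prod>i\<in>UNIV. z i ^ Poly_Mapping.lookup m i))"
  by (simp add: eval_mpoly_def to_ac_vec_def to_ac_sum to_ac_prod)

lemma (in adic_ring) poly_coeffs_mem:
  "set (coeffs f) \<subseteq> R \<Longrightarrow> f \<in> polys 0"
  unfolding polys_def
proof (intro CollectI allI)
  fix k assume f: "set (coeffs f) \<subseteq> R"
  have "coeff f k \<in> insert 0 (set (coeffs f))" by (metis range_coeff rangeI)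
  then show "coeff f k \<in> filt 0" using f zero_mem by auto
qed

text \<open>
  Horner's scheme: the value at \<open>\<alpha> + t a\<close> is \<open>\<phi>\<^sub>\<alpha>(z) + \<phi>\<^sub>t(\<phi>\<^sub>a(z))\<close>.
\<close>

lemma (in adic_ring) drinfeld_orbit_mem:
  fixes \<phi> :: "'f::{finite,field} poly \<Rightarrow> 'k poly"
  assumes \<phi>: "drinfeld_module \<iota> \<phi>"
    and const: "\<And>\<alpha>. \<phi> [:\<alpha>:] \<in> polys 0" and t: "\<phi> [:0, 1:] \<in> polys 0" and z: "z \<in> R"
  shows "poly (\<phi> a) z \<in> R"
proof (induction a)
  case 0
  then show ?case using poly_mem_filt[OF const[of 0] z] by simp
next
  case (pCons \<alpha> a)
  note D = drinfeld_moduleD[OF \<phi>]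
  have "pCons \<alpha> a = [:\<alpha>:] + [:0, 1:] * a" by simp
  then have "poly (\<phi> (pCons \<alpha> a)) z = poly (\<phi> [:\<alpha>:]) z + poly (\<phi> [:0, 1:]) (poly (\<phi> a) z)"
    by (simp only: D(2,3) poly_add poly_pcompose)
  then show ?case
    using add_mem[OF poly_mem_filt[OF const z, simplified] poly_mem_filt[OF t pCons.IH, simplified]]
    by simp
qed

lemma infinite_UNIV_poly: "infinite (UNIV :: 'f::{comm_semiring_1} poly set)"
proof
  assume "finite (UNIV :: 'f poly set)"
  then have "finite (range (\<lambda>n. monom (1 :: 'f) n))" by (rule finite_subset[rotated]) simp
  moreover have "inj (\<lambda>n. monom (1 :: 'f) n)"
    by (rule injI) (metis degree_monom_eq zero_neq_one)
  ultimately show False using finite_imageD by blast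
qed

text \<open>
  Pigeonhole: the orbit meets finitely many residue classes modulo \<open>\<pi>^M\<close>, so two distinct \<open>a\<close>, \<open>a'\<close> give the
  same class in all coordinates, and \<open>b = a - a'\<close>.
\<close>

lemma (in adic_ring) exists_multiplier_into_filt:
  fixes \<phi> :: "'n::finite \<Rightarrow> 'f::{finite,field} poly \<Rightarrow> 'k poly"
  assumes \<phi>: "\<And>i. drinfeld_module \<iota> (\<phi> i)" and orbit: "\<And>i a. poly (\<phi> i a) (z i) \<in> R"
    and T: "finite T" "\<forall>z\<in>R. \<exists>w\<in>T. (z - w) / \<pi> ^ M \<in> R"
  shows "\<exists>b. b \<noteq> 0 \<and> (\<forall>i. poly (\<phi> i b) (z i) \<in> filt M)"
proof -
  have "\<forall>z\<in>R. \<exists>w. w \<in> T \<and> z - w \<in> filt M" using T(2) by (auto simp: filt_def)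
  then obtain r where r: "\<And>z. z \<in> R \<Longrightarrow> r z \<in> T \<and> z - r z \<in> filt M" by metis
  define c where "c a = (\<lambda>i. r (poly (\<phi> i a) (z i)))" for a
  have "range c \<subseteq> UNIV \<rightarrow>\<^sub>E T" using r orbit by (auto simp: c_def)
  moreover have "finite ((UNIV :: 'n set) \<rightarrow>\<^sub>E T)" using T(1) by (intro finite_PiE) auto
  ultimately have "finite (range c)" by (rule finite_subset)
  then have "\<not> inj c" using infinite_UNIV_poly finite_imageD by blast
  then obtain a a' where aa: "c a = c a'" "a \<noteq> a'" by (auto simp: inj_def)
  have "poly (\<phi> i (a - a')) (z i) \<in> filt M" for i
  proof -
    note D = drinfeld_moduleD[OF \<phi>[of i]]
    have "r (poly (\<phi> i a) (z i)) = r (poly (\<phi> i a') (z i))" using aa(1) by (simp add: c_def fun_eq_iff)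
    then have "poly (\<phi> i a) (z i) - poly (\<phi> i a') (z i) =
        (poly (\<phi> i a) (z i) - r (poly (\<phi> i a) (z i))) - (poly (\<phi> i a') (z i) - r (poly (\<phi> i a') (z i)))"
      by simp
    also have "\<dots> \<in> filt M" by (intro filt_diff conjunct2[OF r] orbit)
    finally have "poly (\<phi> i a) (z i) - poly (\<phi> i a') (z i) \<in> filt M" .
    moreover have "poly (\<phi> i a) (z i) = poly (\<phi> i (a - a')) (z i) + poly (\<phi> i a') (z i)"
      using arg_cong[OF D(2)[of "a - a'" a'], of "\<lambda>f. poly f (z i)"]
      by (simp only: poly_add diff_add_cancel)
    ultimately show ?thesis by simp
  qed
  then show ?thesis using aa(2) by (intro exI[of _ "a - a'"]) simp
qed

text \<open>
  The factor \<open>\<pi>^h\<close> clears the denominators of the coefficients of \<open>f\<close>; it does not change the zeros.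
\<close>

lemma (in adic_ring) analytic_mpoly:
  fixes f :: "('n::finite \<Rightarrow>\<^sub>0 nat) \<Rightarrow>\<^sub>0 'k"
  assumes F: "\<And>i. analytic e (F i)" and e: "\<And>a. e a \<in> R"
  shows "\<exists>h. analytic e (\<lambda>a. \<pi> ^ h * (\<Sum>m\<in>Poly_Mapping.keys f.
           Poly_Mapping.lookup f m * (\<Prod>i\<in>UNIV. F i a ^ Poly_Mapping.lookup m i)))"
proof -
  let ?K = "Poly_Mapping.keys f" and ?c = "Poly_Mapping.lookup f"
  have "\<forall>m. \<exists>h. \<pi> ^ h * ?c m \<in> R" using absorbing by simp
  then obtain h where h: "\<And>m. \<pi> ^ h m * ?c m \<in> R" by metis
  define H where "H = (\<Sum>m\<in>?K. h m)"
  have c: "\<pi> ^ H * ?c m \<in> R" if m: "m \<in> ?K" for m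
  proof -
    have "h m \<le> H" unfolding H_def using m by (simp add: member_le_sum)
    then have "\<pi> ^ H * ?c m = \<pi> ^ (H - h m) * (\<pi> ^ h m * ?c m)"
      by (simp add: power_add[symmetric] mult.assoc[symmetric])
    also have "\<dots> \<in> R" by (intro mult_mem power_mem unif_mem h)
    finally show ?thesis .
  qed
  have "analytic e (\<lambda>a. \<Sum>m\<in>?K. (\<pi> ^ H * ?c m) * (\<Prod>i\<in>UNIV. F i a ^ Poly_Mapping.lookup m i))"
    by (intro analytic_sum analytic_mult analytic_const analytic_prod analytic_power F e c)
  then show ?thesis by (intro exI[of _ H]) (simp add: sum_distrib_left mult.assoc)
qed

text \<open>
  The modulus \<open>b\<close> depends on the point and on \<open>\<phi>\<close> only, so one \<open>b\<close> serves all equations of a variety.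
  Substituting \<open>\<phi>\<^bsub>c + a b\<^esub>(z) = \<phi>\<^sub>c(z) + \<phi>\<^sub>a(\<phi>\<^sub>b(z))\<close> into \<open>f\<close> gives an analytic function of \<open>a\<close>.
\<close>

theorem hypersurface_zeros_finite_or_all:
  fixes \<iota> :: "'f::{finite,field} poly fract \<Rightarrow> 'k::field"
    and \<phi> :: "'n::finite \<Rightarrow> 'f poly \<Rightarrow> 'k poly"
    and z :: "'n \<Rightarrow> 'k"
  assumes \<iota>: "finite_field_extension \<iota>" and \<phi>: "\<And>i. drinfeld_module \<iota> (\<phi> i)"
  shows "\<exists>b. b \<noteq> 0 \<and> (\<forall>f c. finite {a. eval_mpoly f (act \<phi> (c + a * b) (to_ac_vec z)) = 0} \<or>
           {a. eval_mpoly f (act \<phi> (c + a * b) (to_ac_vec z)) = 0} = UNIV)"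
proof -
  define t where "t = ([:0, 1:] :: 'f poly)"
  define E where "E = range z \<union> (\<Union>i. \<Union>\<alpha>. set (coeffs (\<phi> i [:\<alpha>:]))) \<union> (\<Union>i. set (coeffs (\<phi> i t)))"
  have "finite E" by (auto simp: E_def)
  obtain R \<pi> where "adic_ring R \<pi> \<and> E \<subseteq> R \<and> (\<forall>a. \<iota> (to_fract a) \<in> R) \<and>
      (\<forall>j>0. \<pi> / \<iota> (to_fract ([:0, 1:] ^ CARD('f) ^ j - [:0, 1:])) \<in> R) \<and>
      (\<exists>T. finite T \<and> (\<forall>z\<in>R. \<exists>w\<in>T. (z - w) / \<pi> ^ 2 \<in> R))"
    using exists_adic_ring[OF \<iota> \<open>finite E\<close>] by (elim exE) (rule that)
  then obtain T where R: "adic_ring R \<pi>" and ER: "E \<subseteq> R"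
    and eR: "\<And>a. \<iota> (to_fract a) \<in> R"
    and unram: "\<And>j. j > 0 \<Longrightarrow> \<pi> / \<iota> (to_fract ([:0, 1:] ^ CARD('f) ^ j - [:0, 1:])) \<in> R"
    and T: "finite T" "\<forall>z\<in>R. \<exists>w\<in>T. (z - w) / \<pi> ^ 2 \<in> R"
    by blast
  interpret adic_ring R \<pi> by (rule R)
  note D = drinfeld_moduleD[OF \<phi>]
  have "set (coeffs (\<phi> i [:\<alpha>:])) \<subseteq> E" for i \<alpha>
    by (rule subsetI) (auto simp: E_def)
  then have const: "\<phi> i [:\<alpha>:] \<in> polys 0" for i \<alpha>
    using ER by (intro poly_coeffs_mem) (rule subset_trans)
  have "set (coeffs (\<phi> i [:0, 1:])) \<subseteq> E" for i
    by (rule subsetI) (auto simp: E_def t_def)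
  then have t: "\<phi> i [:0, 1:] \<in> polys 0" for i
    using ER by (intro poly_coeffs_mem) (rule subset_trans)
  have orbit: "poly (\<phi> i a) (z i) \<in> R" for i a
    by (rule drinfeld_orbit_mem[OF \<phi> const t]) (use ER in \<open>auto simp: E_def\<close>)
  obtain b where b: "b \<noteq> 0" "\<And>i. poly (\<phi> i b) (z i) \<in> filt 2"
    using exists_multiplier_into_filt[where \<phi> = \<phi> and z = z, OF \<phi> orbit T] by blast
  define e where "e a = \<iota> (to_fract a)" for a
  have inj: "inj e"
  proof (rule injI)
    fix a a' assume "e a = e a'"
    then have "\<iota> (to_fract (a - a')) = 0"
      by (simp add: e_def finite_field_extension_hom[OF \<iota>])
    then show "a = a'" by (simp add: finite_field_extension_hom(9)[OF \<iota>] del: to_fract_diff)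
  qed
  have "finite {a. eval_mpoly f (act \<phi> (c + a * b) (to_ac_vec z)) = 0} \<or>
      {a. eval_mpoly f (act \<phi> (c + a * b) (to_ac_vec z)) = 0} = UNIV" for f c
  proof -
    define F where "F i a = poly (\<phi> i c) (z i) + poly (\<phi> i a) (poly (\<phi> i b) (z i))" for i a
    have F: "poly (\<phi> i (c + a * b)) (z i) = F i a" for i a
      by (simp add: F_def D(2,3) poly_pcompose)
    have "analytic e (F i)" for i
      unfolding F_def e_def
      by (intro analytic_add analytic_const orbit drinfeld_orbit_analytic[OF \<iota> \<phi>] unram eR b(2))
        (use t in \<open>auto simp: polys_def\<close>)
    then obtain h where an: "analytic e (\<lambda>a. \<pi> ^ h * (\<Sum>m\<in>Poly_Mapping.keys f.
           Poly_Mapping.lookup f m * (\<Prod>i\<in>UNIV. F i a ^ Poly_Mapping.lookup m i)))" (is "analytic e ?G")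
      using analytic_mpoly[of e F f] eR e_def by auto
    have zero: "eval_mpoly f (act \<phi> (c + a * b) (to_ac_vec z)) = 0 \<longleftrightarrow> ?G a = 0" for a
      by (simp add: act_to_ac_vec F eval_mpoly_to_ac_vec unif_nonzero)
    have "finite {a. ?G a = 0} \<or> (\<forall>a. ?G a = 0)"
      using strassmann[OF an inj] eR unfolding e_def by blast
    then show ?thesis unfolding zero by auto
  qed
  then show ?thesis using b(1) by blast
qed

text \<open>
  A residue class \<open>c + b A\<close> corresponds to a coset of the submodule generated by \<open>\<phi>\<^sub>b(z)\<close>, and a single
  element of \<open>A\<close> to a coset of the zero submodule.
\<close>

lemma finite_union_of_cosets:
  fixes \<phi> :: "'n::finite \<Rightarrow> 'f::{finite,field} poly \<Rightarrow> 'k::field poly"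
  assumes \<phi>: "\<And>i. drinfeld_module \<iota> (\<phi> i)"
    and b: "b \<noteq> 0" and Z: "\<And>c. finite {a. c + a * b \<in> N} \<or> {a. c + a * b \<in> N} = UNIV"
  shows "\<exists>\<C>. finite \<C> \<and> (\<forall>C\<in>\<C>. is_coset_in \<phi> (cyclic_submodule \<phi> (to_ac_vec z)) C) \<and>
           (\<lambda>a. act \<phi> a (to_ac_vec z)) ` N = \<Union>\<C>"
proof -
  note D = drinfeld_moduleD[OF \<phi>]
  define u where "u a = act \<phi> a (to_ac_vec z)" for a
  have u_add: "u (a + a') = u a + u a'" for a a'
    by (simp add: u_def act_to_ac_vec to_ac_vec_add D(2))
  have u_act: "act \<phi> a (u a') = u (a * a')" for a a'
    by (simp add: u_def act_to_ac_vec D(3) poly_pcompose)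
  have u_0: "u 0 = 0" using u_add[of 0 0] by simp
  have u_minus: "- u a = u (- a)" for a
    using u_add[of a "- a"] by (simp add: u_0 minus_unique)
  have coset: "is_coset_in \<phi> (cyclic_submodule \<phi> (to_ac_vec z)) (range (\<lambda>a. u (c + a * b)))" for c b
  proof -
    define H where "H = range (\<lambda>a. u (a * b))"
    have "is_submodule \<phi> H" unfolding is_submodule_def
    proof (intro conjI ballI allI)
      show "0 \<in> H" unfolding H_def by (rule range_eqI[of _ _ 0]) (simp add: u_0)
      show "x + y \<in> H" if xy: "x \<in> H" "y \<in> H" for x y
      proof -
        obtain a a' where "x = u (a * b)" "y = u (a' * b)" using xy by (auto simp: H_def)
        then have "x + y = u ((a + a') * b)" by (simp add: u_add distrib_right)
        then show ?thesis unfolding H_def by blast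
      qed
      show "- x \<in> H" if x: "x \<in> H" for x
      proof -
        obtain a where "x = u (a * b)" using x by (auto simp: H_def)
        then have "- x = u (- a * b)" by (simp add: u_minus)
        then show ?thesis unfolding H_def by blast
      qed
      show "act \<phi> a x \<in> H" if x: "x \<in> H" for a x
      proof -
        obtain a' where "x = u (a' * b)" using x by (auto simp: H_def)
        then have "act \<phi> a x = u (a * a' * b)" by (simp add: u_act mult.assoc)
        then show ?thesis unfolding H_def by blast
      qed
    qed
    moreover have "H \<subseteq> cyclic_submodule \<phi> (to_ac_vec z)" "u c \<in> cyclic_submodule \<phi> (to_ac_vec z)"
      by (auto simp: H_def cyclic_submodule_def u_def)
    moreover have "range (\<lambda>a. u (c + a * b)) = (\<lambda>h. u c + h) ` H"
      by (auto simp: H_def u_add image_image)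
    ultimately show ?thesis unfolding is_coset_in_def by blast
  qed
  have point: "is_coset_in \<phi> (cyclic_submodule \<phi> (to_ac_vec z)) {u a}" for a
    using coset[of a 0] by simp
  define cosets_at where "cosets_at c = (if {a. c + a * b \<in> N} = UNIV then {range (\<lambda>a. u (c + a * b))}
      else (\<lambda>a. {u (c + a * b)}) ` {a. c + a * b \<in> N})" for c
  define M where "M = range (\<lambda>a. a mod b)"
  define K where "K c = {c + a * b | a. True}" for c
  define \<C> where "\<C> = (\<Union>c\<in>M. cosets_at c)"
  have "finite (cosets_at c)" for c using Z[of c] by (auto simp: cosets_at_def)
  then have "finite \<C>" unfolding \<C>_def M_def using finite_range_mod[OF b] by (intro finite_UN_I)
  moreover have "\<forall>C\<in>\<C>. is_coset_in \<phi> (cyclic_submodule \<phi> (to_ac_vec z)) C"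
    using coset point by (auto simp: \<C>_def cosets_at_def split: if_splits)
  moreover have "u ` N = \<Union>\<C>"
  proof -
    have UX: "\<Union>(cosets_at c) = u ` (K c \<inter> N)" for c
      by (auto simp: cosets_at_def K_def split: if_splits)
    have "(\<Union>c\<in>M. K c) = UNIV"
    proof (rule UNIV_eq_I[symmetric])
      fix a
      have "a \<in> K (a mod b)"
        unfolding K_def by (intro CollectI exI[of _ "a div b"]) simp
      then show "a \<in> (\<Union>c\<in>M. K c)" by (auto simp: M_def)
    qed
    then have "u ` N = u ` ((\<Union>c\<in>M. K c) \<inter> N)" by simp
    also have "\<dots> = (\<Union>c\<in>M. \<Union>(cosets_at c))" unfolding UX by blast
    also have "\<dots> = \<Union>\<C>" unfolding \<C>_def by blast
    finally show ?thesis .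
  qed
  ultimately show ?thesis unfolding u_def by blast
qed

theorem theorem2p5:
  fixes \<iota> :: "'f::{finite,field} poly fract \<Rightarrow> 'k::field"
    and \<phi> :: "'n::finite \<Rightarrow> 'f poly \<Rightarrow> 'k poly"
    and x :: "'k alg_closure ^ 'n"
    and \<Gamma> V :: "('k alg_closure ^ 'n) set"
  assumes "finite_field_extension \<iota>"
    and "\<And>i. drinfeld_module \<iota> (\<phi> i)"
    and "x \<in> rational_points"
    and "\<Gamma> = cyclic_submodule \<phi> x"
    and "subvariety_over_base V"
  shows "\<exists>\<C>. finite \<C> \<and> (\<forall>C\<in>\<C>. is_coset_in \<phi> \<Gamma> C) \<and>
           (V \<inter> rational_points) \<inter> \<Gamma> = \<Union>\<C>"
proof -
  obtain z where x: "x = to_ac_vec z" using assms(3) by (auto simp: rational_points_eq)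
  obtain S :: "(('n \<Rightarrow>\<^sub>0 nat) \<Rightarrow>\<^sub>0 'k) set" where V: "V = {v. \<forall>f\<in>S. eval_mpoly f v = 0}"
    using assms(5) by (auto simp: subvariety_over_base_def)
  obtain b where b: "b \<noteq> 0"
    "\<And>f c. finite {a. eval_mpoly f (act \<phi> (c + a * b) (to_ac_vec z)) = 0} \<or>
      {a. eval_mpoly f (act \<phi> (c + a * b) (to_ac_vec z)) = 0} = UNIV"
    using hypersurface_zeros_finite_or_all[where \<phi> = \<phi> and z = z, OF assms(1,2)] by blast
  define N where "N = {a. act \<phi> a (to_ac_vec z) \<in> V}"
  have "finite {a. c + a * b \<in> N} \<or> {a. c + a * b \<in> N} = UNIV" for c
  proof (cases "\<forall>f\<in>S. {a. eval_mpoly f (act \<phi> (c + a * b) (to_ac_vec z)) = 0} = UNIV")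
    case True
    then show ?thesis by (auto simp: N_def V)
  next
    case False
    then obtain f where f: "f \<in> S" "finite {a. eval_mpoly f (act \<phi> (c + a * b) (to_ac_vec z)) = 0}"
      using b(2) by blast
    have "{a. c + a * b \<in> N} \<subseteq> {a. eval_mpoly f (act \<phi> (c + a * b) (to_ac_vec z)) = 0}"
      using f(1) by (auto simp: N_def V)
    then show ?thesis using f(2) finite_subset by blast
  qed
  note cosets = finite_union_of_cosets[where \<phi> = \<phi> and z = z, OF assms(2) b(1) this]
  have "(V \<inter> rational_points) \<inter> \<Gamma> = (\<lambda>a. act \<phi> a (to_ac_vec z)) ` N"
    by (auto simp: assms(4) x N_def cyclic_submodule_def rational_points_eq act_to_ac_vec)
  then show ?thesis using cosets by (simp add: assms(4) x)
qed

end
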